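(* Let $\mathcal M$ be a partial GW*-algebra on a dense subspace $\mathcal D$ of a Hilbert space $\mathcal H$, and let $E$ be a projection with $E\restriction_{\mathcal D}\in\mathcal M$ and $E\mathcal D\subset\mathcal D$. Then the full closure of $\mathcal M_E=\{EX\restriction_{E\mathcal D}:X\in\mathcal M\}$ is a partial GW*-algebra on $\widehat{\mathcal D}(\mathcal M_E)$.
   Context: $\mathcal L^\dagger(\mathcal D,\mathcal H)$ is the set of linear operators $X$ with $D(X)=\mathcal D$, $D(X^* )\supseteq\mathcal D$, with involution $X^\dagger=X^*\restriction_{\mathcal D}$, and weak partial multiplication $X_1\,\square\, X_2={X_1^\dagger}^*X_2$, defined iff $X_2\mathcal D\subset D({X_1^\dagger}^* )$ and $X_1^*\mathcal D\subset D(X_2^* )$. An O*-vector space is a $\dagger$-invariant subspace of $\mathcal L^\dagger(\mathcal D,\mathcal H)$; a (weak) partial O*-algebra is an O*-vector space closed under $\square$ whenever defined. For an O*-vector space $\mathcal M$: $\widehat{\mathcal D}(\mathcal M)=\bigcap_{X\in\mathcal M}D(\overline X)$, the full closure is $\widehat{\mathcal M}=\{\overline X\restriction_{\widehat{\mathcal D}(\mathcal M)}:X\in\mathcal M\}$ on $\widehat{\mathcal D}(\mathcal M)$, and $\mathcal M$ is fully closed if $\widehat{\mathcal D}(\mathcal M)=\mathcal D$. Weak commutant: $\mathcal M'_{\rm w}=\{C\in\mathcal B(\mathcal H):\langle CX\xi,\eta\rangle=\langle C\xi,X^\dagger\eta\rangle\ \forall X\in\mathcal M,\ \xi,\eta\in\mathcal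 D\}$. Unbounded bicommutant: $\mathcal M''_{{\rm w}\sigma}=\{X\in\mathcal L^\dagger(\mathcal D,\mathcal H):\langle CX\xi,\eta\rangle=\langle C\xi,X^\dagger\eta\rangle\ \forall C\in\mathcal M'_{\rm w},\ \xi,\eta\in\mathcal D\}$. A fully closed partial O*-algebra $\mathcal M$ on $\mathcal D$ is a partial GW*-algebra if $\mathcal M'_{\rm w}\mathcal D\subset\mathcal D$ and $\mathcal M=\mathcal M''_{{\rm w}\sigma}$. *)

theory Defs
  imports "HOL-Analysis.Analysis"
begin

class complex_inner = real_normed_vector +
  fixes scaleC :: "complex \<Rightarrow> 'a \<Rightarrow> 'a"
    and cinner :: "'a \<Rightarrow> 'a \<Rightarrow> complex"
  assumes scaleC_add_right: "scaleC a (x + y) = scaleC a x + scaleC a y"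
    and scaleC_add_left: "scaleC (a + b) x = scaleC a x + scaleC b x"
    and scaleC_scaleC: "scaleC a (scaleC b x) = scaleC (a * b) x"
    and scaleC_one: "scaleC 1 x = x"
    and scaleR_scaleC: "scaleR r x = scaleC (complex_of_real r) x"
    and cinner_commute: "cinner x y = cnj (cinner y x)"
    and cinner_add_left: "cinner (x + y) z = cinner x z + cinner y z"
    and cinner_scaleC_left: "cinner (scaleC c x) y = cnj c * cinner x y"
    and cinner_self_norm: "cinner x x = complex_of_real ((norm x)\<^sup>2)"

class chilbert_space = complex_inner + complete_space

text \<open>A (possibly unbounded) linear operator in the Hilbert space Hs (a closed complex
subspace of the ambient space) is identified with its graph.\<close>

definition csubspace :: "'h::complex_inner set \<Rightarrow> bool" where
  "csubspace S \<longleftrightarrow> 0 \<in> S \<and> (\<forall>x\<in>S. \<forall>y\<in>S. x + y \<in> S) \<and> (\<forall>c. \<forall>x\<in>S. scaleC c x \<in> S)"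

definition hilbert_carrier :: "'h::chilbert_space set \<Rightarrow> bool" where
  "hilbert_carrier Hs \<longleftrightarrow> csubspace Hs \<and> closed Hs"

definition dense_subspace :: "'h::chilbert_space set \<Rightarrow> 'h set \<Rightarrow> bool" where
  "dense_subspace Hs D \<longleftrightarrow> hilbert_carrier Hs \<and> csubspace D \<and> D \<subseteq> Hs \<and> Hs \<subseteq> closure D"

definition lin_op :: "'h::chilbert_space set \<Rightarrow> ('h \<times> 'h) set \<Rightarrow> bool" where
  "lin_op Hs G \<longleftrightarrow> G \<subseteq> Hs \<times> Hs \<and> (0, 0) \<in> G
     \<and> (\<forall>(a, b)\<in>G. \<forall>(c, d)\<in>G. (a + c, b + d) \<in> G)
     \<and> (\<forall>k. \<forall>(a, b)\<in>G. (scaleC k a, scaleC k b) \<in> G)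
     \<and> (\<forall>y. (0, y) \<in> G \<longrightarrow> y = 0)"

definition adj :: "'h::chilbert_space set \<Rightarrow> ('h \<times> 'h) set \<Rightarrow> ('h \<times> 'h) set" where
  "adj Hs G = {(\<eta>, \<zeta>). \<eta> \<in> Hs \<and> \<zeta> \<in> Hs \<and> (\<forall>(\<xi>, x)\<in>G. cinner x \<eta> = cinner \<xi> \<zeta>)}"

definition Ldag :: "'h::chilbert_space set \<Rightarrow> 'h set \<Rightarrow> ('h \<times> 'h) set set" where
  "Ldag Hs D = {X. lin_op Hs X \<and> Domain X = D \<and> D \<subseteq> Domain (adj Hs X)}"

definition dag :: "'h::chilbert_space set \<Rightarrow> 'h set \<Rightarrow> ('h \<times> 'h) set \<Rightarrow> ('h \<times> 'h) set" where
  "dag Hs D X = adj Hs X \<inter> (D \<times> UNIV)"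

definition op_add :: "('h::chilbert_space \<times> 'h) set \<Rightarrow> ('h \<times> 'h) set \<Rightarrow> ('h \<times> 'h) set" where
  "op_add X Y = {(\<xi>, x + y) | \<xi> x y. (\<xi>, x) \<in> X \<and> (\<xi>, y) \<in> Y}"

definition op_scale :: "complex \<Rightarrow> ('h::chilbert_space \<times> 'h) set \<Rightarrow> ('h \<times> 'h) set" where
  "op_scale c X = {(\<xi>, scaleC c x) | \<xi> x. (\<xi>, x) \<in> X}"

definition wmult_defined :: "'h::chilbert_space set \<Rightarrow> 'h set \<Rightarrow> ('h \<times> 'h) set \<Rightarrow> ('h \<times> 'h) set \<Rightarrow> bool" where
  "wmult_defined Hs D X1 X2 \<longleftrightarrow>
     X2 `` D \<subseteq> Domain (adj Hs (dag Hs D X1)) \<and> adj Hs X1 `` D \<subseteq> Domain (adj Hs X2)"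

definition wmult :: "'h::chilbert_space set \<Rightarrow> 'h set \<Rightarrow> ('h \<times> 'h) set \<Rightarrow> ('h \<times> 'h) set \<Rightarrow> ('h \<times> 'h) set" where
  "wmult Hs D X1 X2 = X2 O adj Hs (dag Hs D X1)"

definition Ostar_vs :: "'h::chilbert_space set \<Rightarrow> 'h set \<Rightarrow> ('h \<times> 'h) set set \<Rightarrow> bool" where
  "Ostar_vs Hs D M \<longleftrightarrow> dense_subspace Hs D \<and> M \<subseteq> Ldag Hs D \<and> M \<noteq> {}
     \<and> (\<forall>X\<in>M. \<forall>Y\<in>M. op_add X Y \<in> M) \<and> (\<forall>c. \<forall>X\<in>M. op_scale c X \<in> M)
     \<and> (\<forall>X\<in>M. dag Hs D X \<in> M)"

definition partial_Oalg :: "'h::chilbert_space set \<Rightarrow> 'h set \<Rightarrow> ('h \<times> 'h) set set \<Rightarrow> bool" where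
  "partial_Oalg Hs D M \<longleftrightarrow> Ostar_vs Hs D M
     \<and> (\<forall>X1\<in>M. \<forall>X2\<in>M. wmult_defined Hs D X1 X2 \<longrightarrow> wmult Hs D X1 X2 \<in> M)"

definition hatD :: "('h::chilbert_space \<times> 'h) set set \<Rightarrow> 'h set" where
  "hatD M = (\<Inter>X\<in>M. Domain (closure X))"

definition full_closure :: "('h::chilbert_space \<times> 'h) set set \<Rightarrow> ('h \<times> 'h) set set" where
  "full_closure M = (\<lambda>X. closure X \<inter> (hatD M \<times> UNIV)) ` M"

definition fully_closed :: "'h::chilbert_space set \<Rightarrow> ('h \<times> 'h) set set \<Rightarrow> bool" where
  "fully_closed D M \<longleftrightarrow> hatD M = D"

text \<open>Bounded (everywhere defined) linear operators on Hs; represented by functions that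
vanish outside Hs.\<close>
definition bop :: "'h::chilbert_space set \<Rightarrow> ('h \<Rightarrow> 'h) \<Rightarrow> bool" where
  "bop Hs C \<longleftrightarrow> C ` Hs \<subseteq> Hs \<and> (\<forall>x. x \<notin> Hs \<longrightarrow> C x = 0)
     \<and> (\<forall>x\<in>Hs. \<forall>y\<in>Hs. C (x + y) = C x + C y)
     \<and> (\<forall>c. \<forall>x\<in>Hs. C (scaleC c x) = scaleC c (C x))
     \<and> (\<exists>K. \<forall>x\<in>Hs. norm (C x) \<le> K * norm x)"

definition wcomm :: "'h::chilbert_space set \<Rightarrow> 'h set \<Rightarrow> ('h \<times> 'h) set set \<Rightarrow> ('h \<Rightarrow> 'h) set" where
  "wcomm Hs D M = {C. bop Hs C \<and>
     (\<forall>X\<in>M. \<forall>(\<xi>, x)\<in>X. \<forall>(\<eta>, y)\<in>dag Hs D X. cinner (C x) \<eta> = cinner (C \<xi>) y)}"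

definition wbicomm :: "'h::chilbert_space set \<Rightarrow> 'h set \<Rightarrow> ('h \<times> 'h) set set \<Rightarrow> ('h \<times> 'h) set set" where
  "wbicomm Hs D M = {X \<in> Ldag Hs D. \<forall>C\<in>wcomm Hs D M.
     \<forall>(\<xi>, x)\<in>X. \<forall>(\<eta>, y)\<in>dag Hs D X. cinner (C x) \<eta> = cinner (C \<xi>) y}"

definition partial_GW :: "'h::chilbert_space set \<Rightarrow> 'h set \<Rightarrow> ('h \<times> 'h) set set \<Rightarrow> bool" where
  "partial_GW Hs D M \<longleftrightarrow> partial_Oalg Hs D M \<and> fully_closed D M
     \<and> (\<forall>C\<in>wcomm Hs D M. C ` D \<subseteq> D) \<and> M = wbicomm Hs D M"

definition is_proj :: "('h::chilbert_space \<Rightarrow> 'h) \<Rightarrow> bool" where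
  "is_proj E \<longleftrightarrow> bop UNIV E \<and> (\<forall>x. E (E x) = E x) \<and> (\<forall>x y. cinner (E x) y = cinner x (E y))"

definition op_of_fun :: "'h set \<Rightarrow> ('h \<Rightarrow> 'h) \<Rightarrow> ('h \<times> 'h) set" where
  "op_of_fun D f = {(\<xi>, f \<xi>) | \<xi>. \<xi> \<in> D}"

definition reduce :: "('h::chilbert_space \<Rightarrow> 'h) \<Rightarrow> 'h set \<Rightarrow> ('h \<times> 'h) set \<Rightarrow> ('h \<times> 'h) set" where
  "reduce E D X = {(\<xi>, E x) | \<xi> x. (\<xi>, x) \<in> X \<and> \<xi> \<in> E ` D}"

end

theory Submission
  imports Defs
begin

text \<open>Write \<open>N\<close> for the weak commutant of \<open>M\<close>. Since \<open>N\<close> maps \<open>D\<close> into itself, it commutes with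
  the operators of \<open>M\<close>, and \<open>E\<close> commutes with \<open>N\<close>. An operator \<open>Y\<close> in the bicommutant of the
  full closure lifts to \<open>Y E\<close> on \<open>D\<close>, which lies in the bicommutant of \<open>M\<close>, hence in \<open>M\<close>; this gives
  the bicommutant property, and closure under the weak product follows from it. It remains to see that an
  element \<open>T\<close> of the weak commutant of the reduced space preserves the domain. No identification
  of \<open>T\<close> with a reduced element of \<open>N\<close> is needed: the projection onto the closed graph of
  a reduced operator has matrix entries that commute with \<open>N\<close>; restricted to \<open>D\<close> they lie in \<open>M\<close>,
  so \<open>T\<close> commutes with them and \<open>T \<oplus> T\<close> preserves every closed graph.\<close>

subsection \<open>Complex inner products\<close>

lemma cinner_add_right: "cinner x (y + z) = cinner x y + cinner x (z::'a::complex_inner)"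
  by (metis cinner_add_left cinner_commute complex_cnj_add)

lemma cinner_scaleC_right: "cinner x (scaleC c y) = c * cinner x (y::'a::complex_inner)"
  by (metis cinner_scaleC_left cinner_commute complex_cnj_mult complex_cnj_cnj)

lemma scaleC_minus1: "scaleC (-1) x = - (x::'a::complex_inner)"
  using scaleR_scaleC[of "-1" x] by simp

lemma scaleC_zero_left [simp]: "scaleC 0 x = (0::'a::complex_inner)"
  using scaleR_scaleC[of 0 x] by simp

lemma scaleC_zero_right [simp]: "scaleC c 0 = (0::'a::complex_inner)"
  using scaleC_add_right[of c 0 0] by simp

lemma scaleC_diff_right: "scaleC c (x - y) = scaleC c x - scaleC c (y::'a::complex_inner)"
  using scaleC_add_right[of c "x - y" y] by (simp add: algebra_simps)

lemma cinner_zero_left [simp]: "cinner 0 (x::'a::complex_inner) = 0"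
  using cinner_add_left[of 0 0 x] by simp

lemma cinner_zero_right [simp]: "cinner (x::'a::complex_inner) 0 = 0"
  using cinner_add_right[of x 0 0] by simp

lemma cinner_diff_left: "cinner (x - y) z = cinner x z - cinner y (z::'a::complex_inner)"
  using cinner_add_left[of "x - y" y z] by simp

lemma cinner_diff_right: "cinner x (y - z) = cinner x y - cinner x (z::'a::complex_inner)"
  using cinner_add_right[of x "y - z" z] by simp

lemma cinner_self_eq_0 [simp]: "cinner x x = 0 \<longleftrightarrow> (x::'a::complex_inner) = 0"
  by (simp add: cinner_self_norm)

lemma norm_scaleC: "norm (scaleC c x) = cmod c * norm (x::'a::complex_inner)"
proof -
  have "complex_of_real ((norm (scaleC c x))\<^sup>2) = c * cnj c * complex_of_real ((norm x)\<^sup>2)"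
    unfolding cinner_self_norm[symmetric] by (simp add: cinner_scaleC_left cinner_scaleC_right)
  also have "\<dots> = complex_of_real ((cmod c * norm x)\<^sup>2)"
    by (simp only: complex_norm_square[symmetric] power_mult_distrib of_real_mult of_real_power)
  finally have "(norm (scaleC c x))\<^sup>2 = (cmod c * norm x)\<^sup>2"
    using of_real_eq_iff by blast
  then show ?thesis
    by (simp add: power2_eq_iff_nonneg)
qed

text \<open>Pythagoras for the component of \<open>w\<close> along \<open>s\<close>, multiplied
  through by \<open>(norm s)\<^sup>2\<close>. Nonnegativity of the left side is the Cauchy-Schwarz
  inequality; its drop by the squared modulus of \<open>cinner s w\<close> is what forces a nearest
  point to be orthogonal.\<close>

lemma norm_diff_component_square:
  fixes s w :: "'a::complex_inner"
  shows "(norm (w - scaleC (cinner s w / (norm s)\<^sup>2) s))\<^sup>2 * (norm s)\<^sup>2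
    = (norm w)\<^sup>2 * (norm s)\<^sup>2 - (cmod (cinner s w))\<^sup>2"
proof (cases "s = 0")
  case False
  define t where "t = cinner s w / (norm s)\<^sup>2"
  have ws: "cinner w s = cnj (cinner s w)"
    by (rule cinner_commute)
  have n0: "complex_of_real (norm s) \<noteq> 0"
    using False by simp
  have *: "cinner (w - scaleC t s) (w - scaleC t s) =
      cinner w w - t * cinner w s - cnj t * (cinner s w - t * cinner s s)"
    by (simp add: cinner_diff_left cinner_diff_right cinner_scaleC_left cinner_scaleC_right algebra_simps)
  \<comment> \<open>The coefficient \<open>t\<close> is chosen so that the remainder is orthogonal
    to \<open>s\<close>, which kills the last term of the expansion.\<close>
  have "cinner s w - t * cinner s s = 0"
    using n0 by (simp add: t_def cinner_self_norm field_simps)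
  with * have "complex_of_real ((norm (w - scaleC t s))\<^sup>2) = complex_of_real ((norm w)\<^sup>2) - t * cinner w s"
    by (simp add: cinner_self_norm)
  then have "complex_of_real ((norm (w - scaleC t s))\<^sup>2) * complex_of_real ((norm s)\<^sup>2) =
     complex_of_real ((norm w)\<^sup>2) * complex_of_real ((norm s)\<^sup>2) - cinner s w * cnj (cinner s w)"
    using n0 by (simp add: t_def ws field_simps)
  also have "\<dots> = complex_of_real ((norm w)\<^sup>2 * (norm s)\<^sup>2 - (cmod (cinner s w))\<^sup>2)"
    by (simp only: complex_norm_square[symmetric] of_real_mult of_real_diff of_real_power)
  finally show ?thesis
    unfolding t_def[symmetric] of_real_mult[symmetric] of_real_eq_iff .
qed simp

lemma cinner_Cauchy_Schwarz: "cmod (cinner x y) \<le> norm x * norm (y::'a::complex_inner)"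
proof -
  have "0 \<le> (norm y)\<^sup>2 * (norm x)\<^sup>2 - (cmod (cinner x y))\<^sup>2"
    unfolding norm_diff_component_square[symmetric] by simp
  then have "(cmod (cinner x y))\<^sup>2 \<le> (norm x * norm y)\<^sup>2"
    by (simp add: power_mult_distrib mult.commute)
  then show ?thesis
    by (rule power2_le_imp_le) simp
qed

lemma bounded_bilinear_cinner: "bounded_bilinear (cinner :: 'a::complex_inner \<Rightarrow> _)"
proof
  show "\<exists>K. \<forall>a b. cmod (cinner a (b::'a)) \<le> norm a * norm b * K"
    by (intro exI[of _ 1]) (simp add: cinner_Cauchy_Schwarz)
qed (simp_all add: cinner_add_left cinner_add_right scaleR_scaleC cinner_scaleC_left
    cinner_scaleC_right scaleR_conv_of_real)

lemmas tendsto_cinner [tendsto_intros] = bounded_bilinear.tendsto[OF bounded_bilinear_cinner]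
lemmas continuous_on_cinner [continuous_intros] =
  bounded_bilinear.continuous_on[OF bounded_bilinear_cinner]

lemma bounded_linear_scaleC: "bounded_linear (scaleC c :: 'a::complex_inner \<Rightarrow> 'a)"
proof
  show "\<exists>K. \<forall>x::'a. norm (scaleC c x) \<le> norm x * K"
    by (intro exI[of _ "cmod c"]) (simp add: norm_scaleC)
qed (simp_all add: scaleC_add_right scaleR_scaleC scaleC_scaleC mult.commute)

lemmas tendsto_scaleC [tendsto_intros] = bounded_linear.tendsto[OF bounded_linear_scaleC]

section \<open>The Hilbert space of pairs, in which graphs are subspaces\<close>

instantiation prod :: (complex_inner, complex_inner) complex_inner
begin

definition scaleC_prod :: "complex \<Rightarrow> 'a \<times> 'b \<Rightarrow> 'a \<times> 'b" where
  "scaleC_prod c p = (scaleC c (fst p), scaleC c (snd p))"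

definition cinner_prod :: "'a \<times> 'b \<Rightarrow> 'a \<times> 'b \<Rightarrow> complex" where
  "cinner_prod p q = cinner (fst p) (fst q) + cinner (snd p) (snd q)"

instance
proof
  fix x y :: "'a \<times> 'b"
  show "cinner x y = cnj (cinner y x)"
    unfolding cinner_prod_def complex_cnj_add by (metis cinner_commute)
  \<comment> \<open>The product norm is Euclidean, hence it is the norm of the summed inner
    product.\<close>
  show "cinner x x = complex_of_real ((norm x)\<^sup>2)"
    by (simp add: cinner_prod_def norm_prod_def cinner_self_norm)
qed (auto simp: scaleC_prod_def cinner_prod_def scaleC_add_right scaleC_add_left scaleC_scaleC
    scaleC_one scaleR_scaleC cinner_add_left cinner_scaleC_left algebra_simps)

end

instance prod :: (chilbert_space, chilbert_space) chilbert_space ..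

lemma scaleC_Pair [simp]: "scaleC c (a, b) = (scaleC c a, scaleC c b)"
  by (simp add: scaleC_prod_def)

lemma cinner_Pair [simp]: "cinner (a, b) (c, d) = cinner a c + cinner b d"
  by (simp add: cinner_prod_def)

subsection \<open>Subspaces, orthogonal projections and adjoints\<close>

lemma csubspace_0: "csubspace S \<Longrightarrow> 0 \<in> S"
  and csubspace_add: "csubspace S \<Longrightarrow> x \<in> S \<Longrightarrow> y \<in> S \<Longrightarrow> x + y \<in> S"
  and csubspace_scaleC: "csubspace S \<Longrightarrow> x \<in> S \<Longrightarrow> scaleC c x \<in> S"
  by (auto simp: csubspace_def)

lemma csubspace_diff: "csubspace S \<Longrightarrow> x \<in> S \<Longrightarrow> y \<in> S \<Longrightarrow> x - y \<in> S"
  using csubspace_add[of S x "scaleC (-1) y"] csubspace_scaleC[of S y "-1"]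
  by (simp add: scaleC_minus1)

lemma csubspace_closure:
  fixes S :: "'a::complex_inner set"
  assumes "csubspace S" shows "csubspace (closure S)"
  unfolding csubspace_def
proof (intro conjI ballI allI)
  show "0 \<in> closure S"
    using assms csubspace_0 closure_subset by blast
  show "x + y \<in> closure S" if "x \<in> closure S" "y \<in> closure S" for x y
  proof -
    obtain f g where "\<And>n. f n \<in> S" "f \<longlonglongrightarrow> x" "\<And>n. g n \<in> S" "g \<longlonglongrightarrow> y"
      using \<open>x \<in> closure S\<close> \<open>y \<in> closure S\<close> unfolding closure_sequential by blast
    then show ?thesis
      unfolding closure_sequential
      by (intro exI[of _ "\<lambda>n. f n + g n"]) (auto intro!: tendsto_add csubspace_add[OF assms])
  qed
  show "scaleC c x \<in> closure S" if "x \<in> closure S" for c x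
  proof -
    obtain f where "\<And>n. f n \<in> S" "f \<longlonglongrightarrow> x"
      using \<open>x \<in> closure S\<close> unfolding closure_sequential by metis
    then show ?thesis
      unfolding closure_sequential
      by (intro exI[of _ "\<lambda>n. scaleC c (f n)"]) (auto intro!: tendsto_scaleC csubspace_scaleC[OF assms])
  qed
qed

text \<open>The vector \<open>x - y\<close> lies in \<open>closure D\<close>, so by continuity it
  may serve as its own test vector. Membership in \<open>H\<close> matters: \<open>D\<close> is
  dense in \<open>H\<close>, which may be a proper subspace of the ambient space.\<close>

lemma cinner_eq_on_dense:
  fixes D :: "'a::complex_inner set"
  assumes "csubspace H" "H \<subseteq> closure D" "x \<in> H" "y \<in> H"
    and "\<And>\<eta>. \<eta> \<in> D \<Longrightarrow> cinner x \<eta> = cinner y \<eta>"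
  shows "x = y"
proof -
  have "closed {\<eta>. cinner (x - y) \<eta> = 0}"
    by (intro closed_Collect_eq continuous_intros)
  moreover have "D \<subseteq> {\<eta>. cinner (x - y) \<eta> = 0}"
    using assms(5) by (auto simp: cinner_diff_left)
  ultimately have "closure D \<subseteq> {\<eta>. cinner (x - y) \<eta> = 0}"
    by (rule closure_minimal[rotated])
  then have "cinner (x - y) (x - y) = 0"
    using csubspace_diff[OF assms(1,3,4)] assms(2) by blast
  then show ?thesis by simp
qed

section \<open>Orthogonal projection onto a closed subspace\<close>

lemma parallelogram_law:
  "(norm (x + y))\<^sup>2 + (norm (x - y))\<^sup>2 = 2 * (norm x)\<^sup>2 + 2 * (norm (y::'a::complex_inner))\<^sup>2"
proof -
  have "complex_of_real ((norm (x + y))\<^sup>2 + (norm (x - y))\<^sup>2) =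
      complex_of_real (2 * (norm x)\<^sup>2 + 2 * (norm y)\<^sup>2)"
    unfolding of_real_add of_real_mult cinner_self_norm[symmetric]
    by (simp add: cinner_add_left cinner_add_right cinner_diff_left cinner_diff_right)
  then show ?thesis
    using of_real_eq_iff by blast
qed

text \<open>A minimizing sequence is Cauchy by the parallelogram law, and completeness supplies its
  limit.\<close>

lemma nearest_point_exists:
  fixes S :: "'a::chilbert_space set"
  assumes S: "csubspace S" "closed S"
  shows "\<exists>p\<in>S. \<forall>s\<in>S. norm (x - p) \<le> norm (x - s)"
proof -
  define d where "d = (INF s\<in>S. (norm (x - s))\<^sup>2)"
  have ne: "S \<noteq> {}" and bdd: "bdd_below ((\<lambda>s. (norm (x - s))\<^sup>2) ` S)"
    using csubspace_0[OF S(1)] by (auto intro: bdd_belowI[of _ 0])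
  have d_le: "d \<le> (norm (x - s))\<^sup>2" if "s \<in> S" for s
    unfolding d_def by (rule cINF_lower[OF bdd that])
  have "\<exists>s\<in>S. (norm (x - s))\<^sup>2 < d + inverse (real (Suc n))" for n
    using cINF_less_iff[OF ne bdd, of "d + inverse (real (Suc n))"] unfolding d_def by simp
  then obtain p where pS: "\<And>n. p n \<in> S"
    and p: "\<And>n. (norm (x - p n))\<^sup>2 < d + inverse (real (Suc n))"
    by metis
  have bound: "(norm (p m - p n))\<^sup>2 \<le> 2 * inverse (real (Suc m)) + 2 * inverse (real (Suc n))" for m n
  proof -
    \<comment> \<open>The midpoint stays in \<open>S\<close>, so its squared distance to
      \<open>x\<close> is at least \<open>d\<close>; the parallelogram law turns this into an upper
      bound for the distance of \<open>p m\<close> and \<open>p n\<close>.\<close>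
    have half: "scaleC (1/2) (p m + p n) \<in> S"
      using pS S(1) by (intro csubspace_scaleC csubspace_add)
    have "x - p m + (x - p n) = scaleR 2 (x - scaleC (1/2) (p m + p n))"
      using scaleR_scaleC[of 2 "scaleC (1/2) (p m + p n)"]
      by (simp only: scaleR_diff_right scaleC_scaleC) (simp add: scaleC_one scaleR_2)
    then have "(norm (x - p m + (x - p n)))\<^sup>2 = 4 * (norm (x - scaleC (1/2) (p m + p n)))\<^sup>2"
      by (simp add: power_mult_distrib)
    moreover have "(norm (x - p m - (x - p n)))\<^sup>2 = (norm (p m - p n))\<^sup>2"
      by (simp add: norm_minus_commute)
    ultimately show ?thesis
      using parallelogram_law[of "x - p m" "x - p n"] d_le[OF half] p[of m] p[of n] by linarith
  qed
  have "Cauchy p"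
  proof (rule metric_CauchyI)
    fix e :: real assume "0 < e"
    then obtain N where N: "inverse (real (Suc N)) < e\<^sup>2 / 4"
      using reals_Archimedean[of "e\<^sup>2 / 4"] by auto
    have "dist (p m) (p n) < e" if "N \<le> m" "N \<le> n" for m n
    proof -
      have "inverse (real (Suc m)) \<le> inverse (real (Suc N))" "inverse (real (Suc n)) \<le> inverse (real (Suc N))"
        using that by (simp_all add: le_imp_inverse_le)
      then have "(norm (p m - p n))\<^sup>2 < e\<^sup>2"
        using bound[of m n] N by linarith
      then show ?thesis
        using \<open>0 < e\<close> by (simp add: dist_norm power2_less_imp_less)
    qed
    then show "\<exists>M. \<forall>m\<ge>M. \<forall>n\<ge>M. dist (p m) (p n) < e" by blast
  qed
  then obtain q where q: "p \<longlonglongrightarrow> q"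
    using Cauchy_convergent_iff convergent_def by blast
  then have "q \<in> S"
    using closed_sequentially[OF S(2)] pS by blast
  have "(\<lambda>n. (norm (x - p n))\<^sup>2) \<longlonglongrightarrow> (norm (x - q))\<^sup>2"
    by (intro tendsto_intros q)
  moreover have "(\<lambda>n. d + inverse (real (Suc n))) \<longlonglongrightarrow> d + 0"
    by (intro tendsto_intros LIMSEQ_inverse_real_of_nat)
  ultimately have "(norm (x - q))\<^sup>2 \<le> d + 0"
    using p by (intro LIMSEQ_le) (auto intro: less_imp_le)
  then have "norm (x - q) \<le> norm (x - s)" if "s \<in> S" for s
    using power2_le_imp_le[OF order_trans[OF _ d_le[OF that]]] by simp
  with \<open>q \<in> S\<close> show ?thesis by blast
qed

text \<open>Specified by orthogonality of the residual instead of minimality: the condition is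
  linear, and it is the one verified whenever a projection is computed. Minimality is used only for
  existence.\<close>

definition cproj :: "'a::chilbert_space set \<Rightarrow> 'a \<Rightarrow> 'a" where
  "cproj S x = (SOME p. p \<in> S \<and> (\<forall>s\<in>S. cinner s (x - p) = 0))"

lemma
  fixes S :: "'a::chilbert_space set"
  assumes S: "csubspace S" "closed S"
  shows cproj_in: "cproj S x \<in> S"
    and cproj_orth: "s \<in> S \<Longrightarrow> cinner s (x - cproj S x) = 0"
proof -
  obtain p where p: "p \<in> S" "\<And>s. s \<in> S \<Longrightarrow> norm (x - p) \<le> norm (x - s)"
    using nearest_point_exists[OF S] by blast
  have "cinner s (x - p) = 0" if "s \<in> S" for s
  proof (cases "s = 0")
    case False
    \<comment> \<open>Moving \<open>p\<close> by this multiple of \<open>s\<close> gives the best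
      approximation along \<open>s\<close>. As \<open>p\<close> is already nearest, the possible
      gain, the squared modulus of \<open>cinner s (x - p)\<close> up to the factor
      \<open>(norm s)\<^sup>2\<close>, must vanish.\<close>
    let ?t = "cinner s (x - p) / (norm s)\<^sup>2"
    have "p + scaleC ?t s \<in> S"
      using p(1) that S(1) by (intro csubspace_add csubspace_scaleC)
    then have "norm (x - p) \<le> norm (x - p - scaleC ?t s)"
      using p(2) by (simp add: diff_diff_eq)
    then have "(norm (x - p))\<^sup>2 * (norm s)\<^sup>2 \<le> (norm (x - p - scaleC ?t s))\<^sup>2 * (norm s)\<^sup>2"
      by (intro mult_right_mono power_mono) auto
    then show ?thesis
      unfolding norm_diff_component_square by simp
  qed simp
  with p(1) have "\<exists>p. p \<in> S \<and> (\<forall>s\<in>S. cinner s (x - p) = 0)" by blast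
  from someI_ex[OF this] show "cproj S x \<in> S" "s \<in> S \<Longrightarrow> cinner s (x - cproj S x) = 0"
    unfolding cproj_def by blast+
qed

text \<open>Two candidates differ by a vector of \<open>S\<close> that is orthogonal to
  \<open>S\<close>, hence to itself.\<close>

lemma cproj_eqI:
  fixes S :: "'a::chilbert_space set"
  assumes S: "csubspace S" "closed S" and p: "p \<in> S" "\<And>s. s \<in> S \<Longrightarrow> cinner s (x - p) = 0"
  shows "cproj S x = p"
proof -
  let ?s = "cproj S x - p"
  have s: "?s \<in> S"
    using S p(1) by (intro csubspace_diff cproj_in)
  have "?s = (x - p) - (x - cproj S x)" by simp
  then have "cinner ?s ?s = 0"
    by (metis s p(2) cproj_orth[OF S s] cinner_diff_right diff_self)
  then show ?thesis by simp
qed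

lemma cproj_ident: "csubspace S \<Longrightarrow> closed S \<Longrightarrow> x \<in> S \<Longrightarrow> cproj S x = (x::'a::chilbert_space)"
  by (rule cproj_eqI) auto

lemma cproj_add:
  assumes "csubspace S" "closed S"
  shows "cproj S (x + y) = cproj S x + cproj S (y::'a::chilbert_space)"
proof (rule cproj_eqI[OF assms])
  fix s assume s: "s \<in> S"
  have "x + y - (cproj S x + cproj S y) = (x - cproj S x) + (y - cproj S y)" by simp
  then show "cinner s (x + y - (cproj S x + cproj S y)) = 0"
    using assms s by (simp only: cinner_add_right cproj_orth) simp
qed (intro csubspace_add cproj_in assms)

lemma cproj_scaleC:
  assumes "csubspace S" "closed S"
  shows "cproj S (scaleC c x) = scaleC c (cproj S (x::'a::chilbert_space))"
  using assms by (intro cproj_eqI csubspace_scaleC cproj_in)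
    (auto simp flip: scaleC_diff_right simp: cinner_scaleC_right cproj_orth)

lemma norm_cproj_le:
  assumes "csubspace S" "closed S"
  shows "norm (cproj S x) \<le> norm (x::'a::chilbert_space)"
proof -
  let ?p = "cproj S x"
  have "cinner ?p ?p = cinner ?p x"
    using cproj_orth[OF assms cproj_in[OF assms], of x x] by (simp add: cinner_diff_right)
  then have "(norm ?p)\<^sup>2 = cmod (cinner ?p x)"
    by (metis cinner_self_norm norm_of_real abs_of_nonneg zero_le_power2)
  then have "norm ?p * norm ?p \<le> norm ?p * norm x"
    by (metis cinner_Cauchy_Schwarz power2_eq_square)
  then show ?thesis
    by (cases "norm ?p = 0") auto
qed

text \<open>The kernel of \<open>f\<close> is closed, and a nonzero vector \<open>w\<close>
  orthogonal to it determines \<open>f\<close> up to a factor. The representing vector stands in the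
  first slot because \<open>cinner\<close> is linear in the second.\<close>

lemma Riesz_representation:
  fixes f :: "'a::chilbert_space \<Rightarrow> complex"
  assumes add: "\<And>x y. f (x + y) = f x + f y" and scale: "\<And>c x. f (scaleC c x) = c * f x"
    and bound: "\<And>x. cmod (f x) \<le> K * norm x"
  shows "\<exists>z. \<forall>x. f x = cinner z x"
proof (cases "\<forall>x. f x = 0")
  case True
  then show ?thesis by (intro exI[of _ 0]) simp
next
  case False
  then obtain u where u: "f u \<noteq> 0" by blast
  have "bounded_linear f"
    by (rule bounded_linear_intro[where K = K])
      (use add scale bound in \<open>auto simp: scaleR_scaleC scaleR_conv_of_real mult.commute\<close>)
  then have "continuous_on UNIV f"
    by (rule linear_continuous_on)
  define S where "S = {x. f x = 0}"
  have f0: "f 0 = 0" using add[of 0 0] by simp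
  have S: "csubspace S" "closed S"
    unfolding S_def csubspace_def using \<open>continuous_on UNIV f\<close>
    by (auto simp: add scale f0 intro!: closed_Collect_eq)
  define w where "w = u - cproj S u"
  have fw: "f w = f u"
    using add[of w "cproj S u"] cproj_in[OF S, of u] by (simp add: w_def S_def)
  then have "w \<noteq> 0" using u f0 by auto
  then have n0: "complex_of_real (norm w) \<noteq> 0" by simp
  have "f x = cinner (scaleC (cnj (f w / (norm w)\<^sup>2)) w) x" for x
  proof -
    \<comment> \<open>With this factor \<open>x - scaleC k w\<close> lies in the kernel and is
      orthogonal to \<open>w\<close>, so \<open>f x\<close> can be read off from
      \<open>cinner w x\<close>.\<close>
    define k where "k = f x / f w"
    have "f (x - scaleC k w) = 0"
      using add[of "x - scaleC k w" "scaleC k w"] u fw by (simp add: k_def scale)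
    then have "cinner (x - scaleC k w) w = 0"
      unfolding w_def using cproj_orth[OF S] by (simp add: S_def)
    then have "cinner w (x - scaleC k w) = 0"
      by (metis cinner_commute complex_cnj_zero)
    then have "cinner w x = k * complex_of_real ((norm w)\<^sup>2)"
      by (simp add: cinner_diff_right cinner_scaleC_right cinner_self_norm)
    then show ?thesis
      using n0 u fw by (simp add: cinner_scaleC_left k_def)
  qed
  then show ?thesis by blast
qed

section \<open>Bounded operators on a closed subspace and their adjoints\<close>

lemma bop_range: "bop H C \<Longrightarrow> x \<in> H \<Longrightarrow> C x \<in> H"
  and bop_add: "bop H C \<Longrightarrow> x \<in> H \<Longrightarrow> y \<in> H \<Longrightarrow> C (x + y) = C x + C y"
  and bop_scaleC: "bop H C \<Longrightarrow> x \<in> H \<Longrightarrow> C (scaleC c x) = scaleC c (C x)"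
  by (auto simp: bop_def)

lemma bop_diff:
  assumes "csubspace H" "bop H C" "x \<in> H" "y \<in> H"
  shows "C (x - y) = C x - C y"
  using bop_add[OF assms(2) csubspace_diff[OF assms(1,3,4)] assms(4)] by simp

lemma bop_tendsto:
  assumes H: "csubspace H" "closed H" and C: "bop H C"
    and f: "\<And>n. f n \<in> H" "f \<longlonglongrightarrow> x"
  shows "(\<lambda>n. C (f n)) \<longlonglongrightarrow> C x"
proof -
  have x: "x \<in> H"
    using closed_sequentially[OF H(2)] f by blast
  obtain K where K: "\<And>x. x \<in> H \<Longrightarrow> norm (C x) \<le> K * norm x"
    using C unfolding bop_def by blast
  have "(\<lambda>n. K * norm (f n - x)) \<longlonglongrightarrow> K * norm (x - x)"
    by (intro tendsto_intros f)
  moreover have "norm (C (f n) - C x) \<le> K * norm (f n - x)" for n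
    using K[OF csubspace_diff[OF H(1) f(1) x]] bop_diff[OF H(1) C f(1) x] by simp
  ultimately have "(\<lambda>n. C (f n) - C x) \<longlonglongrightarrow> 0"
    using Lim_null_comparison[of "\<lambda>n. C (f n) - C x" "\<lambda>n. K * norm (f n - x)" sequentially]
    by simp
  then show ?thesis
    by (simp add: LIM_zero_iff)
qed

text \<open>The Riesz representation concerns functionals on the whole space, so the functional
  given by \<open>C\<close> is first extended by composing with the projection onto
  \<open>H\<close>; the representing vector is then projected back into \<open>H\<close>.\<close>

lemma bop_adjoint_exists:
  assumes H: "csubspace H" "closed H" and C: "bop H C"
  obtains B where "bop H B" "\<And>x y. x \<in> H \<Longrightarrow> y \<in> H \<Longrightarrow> cinner (C x) y = cinner x (B y)"
proof -
  obtain K where K: "\<And>x. x \<in> H \<Longrightarrow> norm (C x) \<le> K * norm x"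
    using C unfolding bop_def by blast
  have "\<exists>z\<in>H. \<forall>x\<in>H. cinner (C x) y = cinner x z" for y
  proof -
    have "\<exists>z. \<forall>x. cinner y (C (cproj H x)) = cinner z x"
    proof (rule Riesz_representation)
      fix a b c
      show "cinner y (C (cproj H (a + b))) = cinner y (C (cproj H a)) + cinner y (C (cproj H b))"
        by (simp add: cproj_add[OF H] bop_add[OF C] cproj_in[OF H] cinner_add_right)
      show "cinner y (C (cproj H (scaleC c a))) = c * cinner y (C (cproj H a))"
        by (simp add: cproj_scaleC[OF H] bop_scaleC[OF C] cproj_in[OF H] cinner_scaleC_right)
      have "norm (C (cproj H a)) \<le> \<bar>K\<bar> * norm a"
        using K[OF cproj_in[OF H], of a] norm_cproj_le[OF H, of a]
        by (smt (verit) mult_mono norm_ge_zero)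
      then show "cmod (cinner y (C (cproj H a))) \<le> (norm y * \<bar>K\<bar>) * norm a"
        using cinner_Cauchy_Schwarz[of y "C (cproj H a)"]
        by (smt (verit) mult_left_mono norm_ge_zero mult.assoc)
    qed
    then obtain z where z: "\<And>x. cinner y (C (cproj H x)) = cinner z x" by blast
    have "cinner (C x) y = cinner x (cproj H z)" if x: "x \<in> H" for x
    proof -
      have "cinner (C x) y = cinner x z"
        using z[of x] cproj_ident[OF H x] by (metis cinner_commute)
      also have "\<dots> = cinner x (cproj H z)"
        using cproj_orth[OF H x, of z] by (simp add: cinner_diff_right)
      finally show ?thesis .
    qed
    then show ?thesis using cproj_in[OF H] by blast
  qed
  then obtain B0 where B0: "\<And>y. B0 y \<in> H" "\<And>x y. x \<in> H \<Longrightarrow> cinner (C x) y = cinner x (B0 y)"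
    by metis
  \<comment> \<open>\<open>bop\<close> demands the value 0 outside \<open>H\<close>, where
    \<open>B0\<close> may be nonzero.\<close>
  define B where "B y = (if y \<in> H then B0 y else 0)" for y
  have eqI: "a = b" if "a \<in> H" "b \<in> H" "\<And>x. x \<in> H \<Longrightarrow> cinner x a = cinner x b" for a b
    using cinner_eq_on_dense[OF H(1) closure_subset that(1,2)] that(3) by (metis cinner_commute)
  have "bop H B"
    unfolding bop_def
  proof (intro conjI allI ballI impI)
    show "B ` H \<subseteq> H" using B0(1) by (auto simp: B_def)
    show "B x = 0" if "x \<notin> H" for x using that by (simp add: B_def)
    show "B (x + y) = B x + B y" if "x \<in> H" "y \<in> H" for x y
    proof -
      have "B0 (x + y) = B0 x + B0 y"
        by (rule eqI) (auto simp: B0(1) csubspace_add[OF H(1)] cinner_add_right simp flip: B0(2))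
      then show ?thesis
        using that by (simp add: B_def csubspace_add[OF H(1)])
    qed
    show "B (scaleC c x) = scaleC c (B x)" if "x \<in> H" for c x
    proof -
      have "B0 (scaleC c x) = scaleC c (B0 x)"
        by (rule eqI) (auto simp: B0(1) csubspace_scaleC[OF H(1)] cinner_scaleC_right simp flip: B0(2))
      then show ?thesis
        using that by (simp add: B_def csubspace_scaleC[OF H(1)])
    qed
    show "\<exists>K. \<forall>x\<in>H. norm (B x) \<le> K * norm x"
    proof (intro exI[of _ "\<bar>K\<bar>"] ballI)
      fix x assume "x \<in> H"
      let ?b = "B0 x"
      \<comment> \<open>The adjoint relation at the vector \<open>?b\<close> itself; Cauchy-Schwarz
        and the bound of \<open>C\<close> then carry the same constant over to
        \<open>B\<close>.\<close>
      have "(norm ?b)\<^sup>2 = cmod (cinner (C ?b) x)"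
        by (metis B0 cinner_self_norm norm_of_real abs_of_nonneg zero_le_power2)
      also have "\<dots> \<le> norm (C ?b) * norm x" by (rule cinner_Cauchy_Schwarz)
      also have "\<dots> \<le> (\<bar>K\<bar> * norm ?b) * norm x"
        using K[OF B0(1), of x] by (intro mult_right_mono) (smt (verit) mult_right_mono norm_ge_zero, simp)
      finally have "norm ?b * norm ?b \<le> norm ?b * (\<bar>K\<bar> * norm x)"
        by (simp add: power2_eq_square algebra_simps)
      then have "norm ?b \<le> \<bar>K\<bar> * norm x"
        by (cases "norm ?b = 0") auto
      then show "norm (B x) \<le> \<bar>K\<bar> * norm x"
        using \<open>x \<in> H\<close> by (simp add: B_def)
    qed
  qed
  then show thesis
    by (rule that) (simp add: B_def B0(2))
qed

subsection \<open>Operators as graphs\<close>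

text \<open>Expresses linearity of a graph as a subspace property in the space of pairs, so that
  closures and intersections of graphs fall under the lemmas on subspaces.\<close>

lemma lin_op_iff:
  "lin_op H G \<longleftrightarrow> G \<subseteq> H \<times> H \<and> csubspace G \<and> (\<forall>y. (0, y) \<in> G \<longrightarrow> y = 0)"
  unfolding lin_op_def csubspace_def zero_prod_def Ball_def split_paired_All by auto

lemma csubspace_PairD:
  assumes "csubspace G"
  shows "(0, 0) \<in> G" "(a, b) \<in> G \<Longrightarrow> (c, d) \<in> G \<Longrightarrow> (a + c, b + d) \<in> G"
    "(a, b) \<in> G \<Longrightarrow> (scaleC k a, scaleC k b) \<in> G"
  using csubspace_0[OF assms] csubspace_add[OF assms, of "(a, b)" "(c, d)"]
    csubspace_scaleC[OF assms, of "(a, b)" k] by (simp_all add: zero_prod_def)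

lemma csubspace_Domain:
  assumes "csubspace G" shows "csubspace (Domain G)"
  unfolding csubspace_def using csubspace_PairD[OF assms] by (blast elim: DomainE intro: DomainI)

lemma csubspace_relcomp:
  assumes "csubspace X" "csubspace Y" shows "csubspace (X O Y)"
  unfolding csubspace_def zero_prod_def
proof (intro conjI ballI allI)
  show "(0, 0) \<in> X O Y"
    using assms by (blast intro: csubspace_PairD(1))
  show "p + q \<in> X O Y" if "p \<in> X O Y" "q \<in> X O Y" for p q
    using that csubspace_PairD(2)[OF assms(1)] csubspace_PairD(2)[OF assms(2)]
    by (auto elim!: relcompE) blast
  show "scaleC k p \<in> X O Y" if "p \<in> X O Y" for k p
    using that csubspace_PairD(3)[OF assms(1)] csubspace_PairD(3)[OF assms(2)]
    by (auto elim!: relcompE) blast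
qed

lemma lin_op_unique:
  assumes "lin_op H G" "(\<xi>, x) \<in> G" "(\<xi>, y) \<in> G"
  shows "x = y"
proof -
  have "(\<xi>, x) - (\<xi>, y) \<in> G"
    using assms by (intro csubspace_diff) (auto simp: lin_op_iff)
  then show ?thesis
    using assms(1) by (auto simp: lin_op_iff)
qed

text \<open>\<open>Y\<close> is single-valued, so a subgraph with at least the same domain exhausts
  it. Equality of operators thereby reduces to one inclusion and a comparison of domains.\<close>

lemma lin_op_eqI:
  assumes "lin_op H Y" "X \<subseteq> Y" "Domain Y \<subseteq> Domain X"
  shows "X = Y"
proof
  show "Y \<subseteq> X"
  proof
    fix p assume p: "p \<in> Y"
    obtain \<xi> y where [simp]: "p = (\<xi>, y)" by (cases p)
    obtain x where x: "(\<xi>, x) \<in> X"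
      using p assms(3) by auto
    then have "x = y"
      using lin_op_unique[OF assms(1)] assms(2) p by auto
    with x show "p \<in> X" by simp
  qed
qed (rule assms)

section \<open>Adjoints of graphs\<close>

lemma adjD: "(\<eta>, \<zeta>) \<in> adj H G \<Longrightarrow> (\<xi>, x) \<in> G \<Longrightarrow> cinner x \<eta> = cinner \<xi> \<zeta>"
  by (auto simp: adj_def)

lemma adjI:
  assumes "\<eta> \<in> H" "\<zeta> \<in> H" "\<And>\<xi> x. (\<xi>, x) \<in> G \<Longrightarrow> cinner x \<eta> = cinner \<xi> \<zeta>"
  shows "(\<eta>, \<zeta>) \<in> adj H G"
  using assms by (auto simp: adj_def)

lemma adj_mono: "X \<subseteq> Y \<Longrightarrow> adj H Y \<subseteq> adj H X"
  by (auto simp: adj_def)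

lemma adj_subset: "adj H G \<subseteq> H \<times> H"
  by (auto simp: adj_def)

lemma csubspace_adj: "csubspace H \<Longrightarrow> csubspace (adj H G)"
  by (fastforce simp: csubspace_def adj_def zero_prod_def cinner_add_right cinner_scaleC_right)

lemma closed_adj: "closed H \<Longrightarrow> closed (adj H G)"
proof -
  assume "closed H"
  have "adj H G = (H \<times> H) \<inter> (\<Inter>g\<in>G. {p. cinner (snd g) (fst p) = cinner (fst g) (snd p)})"
    by (fastforce simp: adj_def)
  also have "closed \<dots>"
    by (intro closed_Int closed_Times closed_INT \<open>closed H\<close> ballI closed_Collect_eq continuous_intros)
  finally show ?thesis .
qed

text \<open>For a fixed pair \<open>(\<eta>, \<zeta>)\<close> the defining equation is a closed
  condition on the elements of the graph.\<close>

lemma adj_closure: "adj H (closure G) = adj H G"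
proof
  show "adj H G \<subseteq> adj H (closure G)"
  proof clarify
    fix \<eta> \<zeta> assume p: "(\<eta>, \<zeta>) \<in> adj H G"
    have "closed {g. cinner (snd g) \<eta> = cinner (fst g) \<zeta>}"
      by (intro closed_Collect_eq continuous_intros)
    moreover have "G \<subseteq> {g. cinner (snd g) \<eta> = cinner (fst g) \<zeta>}"
      using adjD[OF p] by auto
    ultimately have "closure G \<subseteq> {g. cinner (snd g) \<eta> = cinner (fst g) \<zeta>}"
      by (rule closure_minimal[rotated])
    then show "(\<eta>, \<zeta>) \<in> adj H (closure G)"
      using p by (auto simp: adj_def)
  qed
qed (rule adj_mono[OF closure_subset])

lemma adj_between_closure: "X \<subseteq> Y \<Longrightarrow> Y \<subseteq> closure X \<Longrightarrow> adj H Y = adj H X"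
  using adj_mono[of X Y H] adj_mono[of Y "closure X" H] adj_closure[of H X] by blast

section \<open>Sums and scalar multiples of graphs\<close>

lemma op_addE:
  assumes "(\<xi>, z) \<in> op_add X Y"
  obtains x y where "z = x + y" "(\<xi>, x) \<in> X" "(\<xi>, y) \<in> Y"
  using assms by (auto simp: op_add_def)

lemma op_scaleE:
  assumes "(\<xi>, z) \<in> op_scale c X"
  obtains x where "z = scaleC c x" "(\<xi>, x) \<in> X"
  using assms by (auto simp: op_scale_def)

lemma op_add_mono: "X \<subseteq> X' \<Longrightarrow> Y \<subseteq> Y' \<Longrightarrow> op_add X Y \<subseteq> op_add X' Y'"
  unfolding op_add_def by blast

lemma op_scale_mono: "X \<subseteq> X' \<Longrightarrow> op_scale c X \<subseteq> op_scale c X'"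
  unfolding op_scale_def by blast

lemma Domain_op_add: "Domain (op_add X Y) = Domain X \<inter> Domain Y"
  unfolding op_add_def by blast

lemma Domain_op_scale: "Domain (op_scale c X) = Domain X"
  unfolding op_scale_def by blast

text \<open>For unbounded operators only this inclusion holds in general; equality on a common
  domain is regained later by comparing domains.\<close>

lemma op_add_adj_subset:
  assumes "csubspace H"
  shows "op_add (adj H X) (adj H Y) \<subseteq> adj H (op_add X Y)"
proof clarify
  fix \<eta> z assume "(\<eta>, z) \<in> op_add (adj H X) (adj H Y)"
  then obtain x y where [simp]: "z = x + y" and x: "(\<eta>, x) \<in> adj H X" and y: "(\<eta>, y) \<in> adj H Y"
    by (rule op_addE)
  show "(\<eta>, z) \<in> adj H (op_add X Y)"
    using x y adj_subset[of H X] adj_subset[of H Y] csubspace_add[OF assms]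
    by (intro adjI) (auto elim!: op_addE simp: cinner_add_left cinner_add_right adjD[OF x] adjD[OF y])
qed

lemma op_scale_adj_subset:
  assumes "csubspace H"
  shows "op_scale (cnj c) (adj H X) \<subseteq> adj H (op_scale c X)"
proof clarify
  fix \<eta> z assume "(\<eta>, z) \<in> op_scale (cnj c) (adj H X)"
  then obtain x where [simp]: "z = scaleC (cnj c) x" and x: "(\<eta>, x) \<in> adj H X"
    by (rule op_scaleE)
  show "(\<eta>, z) \<in> adj H (op_scale c X)"
    using x adj_subset[of H X] csubspace_scaleC[OF assms]
    by (intro adjI) (auto elim!: op_scaleE simp: cinner_scaleC_left cinner_scaleC_right adjD[OF x])
qed

section \<open>Operators on a dense domain and the involution\<close>

lemma dense_subspaceD:
  assumes "dense_subspace H D"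
  shows "csubspace H" "closed H" "csubspace D" "D \<subseteq> H" "H \<subseteq> closure D"
  using assms by (auto simp: dense_subspace_def hilbert_carrier_def)

text \<open>A value of the adjoint at 0 is orthogonal to the dense set \<open>D\<close>, hence it is
  0.\<close>

lemma lin_op_adj:
  assumes D: "dense_subspace H D" and "D \<subseteq> Domain X"
  shows "lin_op H (adj H X)"
  unfolding lin_op_iff
proof (intro conjI adj_subset csubspace_adj dense_subspaceD(1)[OF D] allI impI)
  fix y assume y: "(0, y) \<in> adj H X"
  have "cinner y \<xi> = cinner 0 \<xi>" if "\<xi> \<in> D" for \<xi>
  proof -
    obtain x where "(\<xi>, x) \<in> X" using \<open>\<xi> \<in> D\<close> assms(2) by auto
    from adjD[OF y this] show ?thesis
      by (metis cinner_commute cinner_zero_left cinner_zero_right)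
  qed
  moreover have "y \<in> H" using y adj_subset by auto
  ultimately show "y = 0"
    using dense_subspaceD[OF D] by (intro cinner_eq_on_dense[of H D]) (auto simp: csubspace_0)
qed

lemma lin_op_subset:
  assumes "lin_op H Y" "csubspace X" "X \<subseteq> Y"
  shows "lin_op H X"
  using assms by (auto simp: lin_op_iff)

lemma dag_subset_adj: "dag H D X \<subseteq> adj H X"
  by (auto simp: dag_def)

lemma in_dag_iff: "(\<eta>, y) \<in> dag H D X \<longleftrightarrow> \<eta> \<in> D \<and> (\<eta>, y) \<in> adj H X"
  by (auto simp: dag_def)

lemma adj_swap: "(\<eta>, y) \<in> adj H X \<Longrightarrow> (\<xi>, x) \<in> X \<Longrightarrow> cinner y \<xi> = cinner \<eta> x"
  using adjD[of \<eta> y H X \<xi> x] cinner_commute[of y \<xi>] cinner_commute[of \<eta> x] by simp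

lemma LdagD:
  assumes "X \<in> Ldag H D"
  shows "lin_op H X" "Domain X = D" "D \<subseteq> Domain (adj H X)" "csubspace X" "X \<subseteq> H \<times> H"
  using assms by (auto simp: Ldag_def lin_op_iff)

text \<open>The pairing between an operator and its adjoint is symmetric up to conjugation. Since
  adjoints are closed, this inclusion later yields closability.\<close>

lemma subset_adj_dag: "X \<subseteq> H \<times> H \<Longrightarrow> X \<subseteq> adj H (dag H D X)"
  using adj_swap by (auto simp: adj_def[of H "dag H D X"] in_dag_iff)

lemma csubspace_Int: "csubspace A \<Longrightarrow> csubspace B \<Longrightarrow> csubspace (A \<inter> B)"
  by (auto simp: csubspace_def)

lemma csubspace_INT: "(\<And>i. i \<in> I \<Longrightarrow> csubspace (f i)) \<Longrightarrow> csubspace (\<Inter>i\<in>I. f i)"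
  by (simp add: csubspace_def)

lemma csubspace_Times_UNIV: "csubspace D \<Longrightarrow> csubspace (D \<times> UNIV)"
  by (auto simp: csubspace_def zero_prod_def)

text \<open>Single-valuedness follows from the other conditions: \<open>X\<close> is contained in
  the adjoint of its \<open>dag\<close>, and that adjoint is an operator because
  \<open>dag H D X\<close> is defined on all of \<open>D\<close>.\<close>

lemma LdagI:
  assumes D: "dense_subspace H D" and X: "X \<subseteq> H \<times> H" "csubspace X" "Domain X = D"
    and "\<And>\<eta>. \<eta> \<in> D \<Longrightarrow> \<exists>y. (\<eta>, y) \<in> adj H X"
  shows "X \<in> Ldag H D"
proof -
  have dom: "D \<subseteq> Domain (adj H X)" using assms(5) by blast
  then have "D \<subseteq> Domain (dag H D X)" by (auto simp: dag_def)
  then have "lin_op H X"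
    using lin_op_subset[OF lin_op_adj[OF D] X(2) subset_adj_dag[OF X(1)]] by blast
  with X dom show ?thesis by (auto simp: Ldag_def)
qed

lemma dag_in_Ldag:
  assumes D: "dense_subspace H D" and X: "X \<in> Ldag H D"
  shows "dag H D X \<in> Ldag H D"
proof (rule LdagI[OF D])
  show "dag H D X \<subseteq> H \<times> H"
    using adj_subset by (auto simp: dag_def)
  show "csubspace (dag H D X)"
    unfolding dag_def using dense_subspaceD[OF D]
    by (intro csubspace_Int csubspace_adj csubspace_Times_UNIV)
  show "Domain (dag H D X) = D"
    using LdagD(3)[OF X] by (auto simp: dag_def)
  show "\<exists>y. (\<eta>, y) \<in> adj H (dag H D X)" if "\<eta> \<in> D" for \<eta>
    using that LdagD(2)[OF X] subset_adj_dag[OF LdagD(5)[OF X], of D] by blast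
qed

text \<open>Any formal adjoint with full domain \<open>D\<close> is a subgraph of the single-valued
  \<open>dag H D X\<close> with the same domain. Most later formulas for \<open>dag\<close> come
  from exhibiting such a \<open>Y\<close>.\<close>

lemma dag_eqI:
  assumes D: "dense_subspace H D" and X: "X \<in> Ldag H D" and "Y \<subseteq> adj H X" "Domain Y = D"
  shows "dag H D X = Y"
proof -
  have "Y \<subseteq> dag H D X" using assms(3,4) by (auto simp: dag_def)
  then show ?thesis
    using lin_op_eqI[OF LdagD(1)[OF dag_in_Ldag[OF D X]], of Y] assms(4) by (auto simp: dag_def)
qed

lemma dag_dag:
  assumes D: "dense_subspace H D" and X: "X \<in> Ldag H D"
  shows "dag H D (dag H D X) = X"
  using dag_eqI[OF D dag_in_Ldag[OF D X]] subset_adj_dag[OF LdagD(5)[OF X]] LdagD(2)[OF X] by blast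

subsection \<open>Weak commutants\<close>

lemma wcommD:
  assumes "C \<in> wcomm H D M"
  shows "bop H C"
    and "X \<in> M \<Longrightarrow> (\<xi>, x) \<in> X \<Longrightarrow> (\<eta>, y) \<in> dag H D X \<Longrightarrow> cinner (C x) \<eta> = cinner (C \<xi>) y"
  using assms unfolding wcomm_def by blast+

lemma wcommI:
  assumes "bop H C" and "\<And>X \<xi> x \<eta> y. X \<in> M \<Longrightarrow> (\<xi>, x) \<in> X \<Longrightarrow> (\<eta>, y) \<in> dag H D X \<Longrightarrow>
      cinner (C x) \<eta> = cinner (C \<xi>) y"
  shows "C \<in> wcomm H D M"
  using assms by (auto simp: wcomm_def)

lemma Ostar_vsD:
  assumes "Ostar_vs H D M"
  shows "dense_subspace H D" "M \<subseteq> Ldag H D" "M \<noteq> {}"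
    "X \<in> M \<Longrightarrow> Y \<in> M \<Longrightarrow> op_add X Y \<in> M" "X \<in> M \<Longrightarrow> op_scale c X \<in> M"
    "X \<in> M \<Longrightarrow> dag H D X \<in> M"
  using assms by (auto simp: Ostar_vs_def)

text \<open>Apply the commutation relation of \<open>C\<close> to \<open>dag H D X\<close>, whose
  own \<open>dag\<close> is \<open>X\<close>, and conjugate.\<close>

lemma wcomm_adjoint:
  assumes M: "Ostar_vs H D M" and C: "C \<in> wcomm H D M" and B: "bop H B"
    and CB: "\<And>x y. x \<in> H \<Longrightarrow> y \<in> H \<Longrightarrow> cinner (C x) y = cinner x (B y)"
  shows "B \<in> wcomm H D M"
proof (rule wcommI[OF B])
  fix X \<xi> x \<eta> y
  assume X: "X \<in> M" and x: "(\<xi>, x) \<in> X" and y: "(\<eta>, y) \<in> dag H D X"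
  note D = Ostar_vsD(1)[OF M]
  have XL: "X \<in> Ldag H D" using X Ostar_vsD(2)[OF M] by blast
  have "(\<xi>, x) \<in> dag H D (dag H D X)" using x dag_dag[OF D XL] by simp
  then have "cinner (C y) \<xi> = cinner (C \<eta>) x"
    by (rule wcommD(2)[OF C Ostar_vsD(6)[OF M X] y])
  moreover have "\<xi> \<in> H" "x \<in> H" "\<eta> \<in> H" "y \<in> H"
    using x y LdagD(5)[OF XL] adj_subset by (auto simp: dag_def)
  ultimately show "cinner (B x) \<eta> = cinner (B \<xi>) y"
    using CB by (metis cinner_commute)
qed

text \<open>Turns weak into strong commutation. The weak relation says that
  \<open>(C \<xi>, C x)\<close> lies in the adjoint of \<open>dag H D X\<close>; once
  \<open>C \<xi>\<close> is in \<open>D\<close>, this is membership in the double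
  \<open>dag\<close>, which is \<open>X\<close>.\<close>

lemma wcomm_commutes:
  assumes M: "Ostar_vs H D M" and C: "C \<in> wcomm H D M" "C ` D \<subseteq> D"
    and X: "X \<in> M" and x: "(\<xi>, x) \<in> X"
  shows "(C \<xi>, C x) \<in> X"
proof -
  note D = Ostar_vsD(1)[OF M]
  have XL: "X \<in> Ldag H D" using X Ostar_vsD(2)[OF M] by blast
  have in_D: "\<xi> \<in> D" and in_H: "\<xi> \<in> H" "x \<in> H"
    using x LdagD(2,5)[OF XL] by auto
  have "C \<xi> \<in> H" "C x \<in> H"
    using in_H bop_range[OF wcommD(1)[OF C(1)]] by auto
  moreover have "cinner y (C \<xi>) = cinner \<eta> (C x)" if "(\<eta>, y) \<in> dag H D X" for \<eta> y
    using wcommD(2)[OF C(1) X x that] by (metis cinner_commute)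
  ultimately have "(C \<xi>, C x) \<in> dag H D (dag H D X)"
    using C(2) in_D by (auto simp: in_dag_iff adj_def)
  then show ?thesis using dag_dag[OF D XL] by simp
qed

text \<open>Invariance of \<open>D\<close> lets the weak commutant commute strongly with both
  factors, so a weak product, when defined, again satisfies the bicommutant condition.\<close>

lemma partial_Oalg_if_wbicomm:
  assumes M: "Ostar_vs H D M" and inv: "\<And>C. C \<in> wcomm H D M \<Longrightarrow> C ` D \<subseteq> D"
    and bicomm: "M = wbicomm H D M"
  shows "partial_Oalg H D M"
  unfolding partial_Oalg_def
proof (intro conjI M ballI impI)
  note D = Ostar_vsD(1)[OF M]
  note H = dense_subspaceD(1,2)[OF D]
  fix X1 X2 assume X: "X1 \<in> M" "X2 \<in> M" and def: "wmult_defined H D X1 X2"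
  have XL: "X1 \<in> Ldag H D" "X2 \<in> Ldag H D" using X Ostar_vsD(2)[OF M] by auto
  let ?Z = "wmult H D X1 X2" and ?A = "adj H (dag H D X1)"
  \<comment> \<open>The candidate for the \<open>dag\<close> of the product: first
    \<open>dag H D X1\<close>, then the adjoint of \<open>X2\<close>. The two halves of
    \<open>wmult_defined\<close> make \<open>?Z\<close> and \<open>W\<close> total on
    \<open>D\<close>.\<close>
  define W where "W = dag H D X1 O adj H X2"
  have A_sub: "?A \<subseteq> H \<times> H" by (rule adj_subset)
  have W_adj: "W \<subseteq> adj H ?Z"
  proof clarify
    fix \<eta> v assume "(\<eta>, v) \<in> W"
    then obtain u where u: "(\<eta>, u) \<in> dag H D X1" and v: "(u, v) \<in> adj H X2"
      by (auto simp: W_def)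
    have "cinner z \<eta> = cinner \<xi> v" if "(\<xi>, x) \<in> X2" "(x, z) \<in> ?A" for \<xi> x z
      using adj_swap[OF that(2) u] adjD[OF v that(1)] by simp
    moreover have "\<eta> \<in> H" "v \<in> H"
      using u v adj_subset by (auto simp: dag_def)
    ultimately show "(\<eta>, v) \<in> adj H ?Z"
      by (auto simp: adj_def[of H "X2 O ?A"] wmult_def)
  qed
  have dom_W: "Domain W = D"
  proof
    show "D \<subseteq> Domain W"
    proof
      fix \<eta> assume "\<eta> \<in> D"
      then obtain u where u: "(\<eta>, u) \<in> dag H D X1"
        using LdagD(2)[OF dag_in_Ldag[OF D XL(1)]] by blast
      then have "u \<in> adj H X1 `` D" by (auto simp: dag_def)
      then obtain v where "(u, v) \<in> adj H X2"
        using def by (auto simp: wmult_defined_def)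
      with u show "\<eta> \<in> Domain W" by (auto simp: W_def)
    qed
  qed (auto simp: W_def dag_def)
  have ZL: "?Z \<in> Ldag H D"
  proof (rule LdagI[OF D])
    show "?Z \<subseteq> H \<times> H"
      using LdagD(5)[OF XL(2)] A_sub by (auto simp: wmult_def)
    show "csubspace ?Z"
      unfolding wmult_def by (intro csubspace_relcomp LdagD(4)[OF XL(2)] csubspace_adj[OF H(1)])
    have "X2 `` D \<subseteq> Domain ?A"
      using def by (simp add: wmult_defined_def)
    then show "Domain ?Z = D"
      unfolding wmult_def LdagD(2)[OF XL(2), symmetric] by blast
    show "\<exists>y. (\<eta>, y) \<in> adj H ?Z" if "\<eta> \<in> D" for \<eta>
      using that W_adj dom_W by blast
  qed
  have dag_Z: "dag H D ?Z = W"
    by (rule dag_eqI[OF D ZL W_adj dom_W])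
  have "?Z \<in> wbicomm H D M"
    unfolding wbicomm_def
  proof (intro CollectI conjI ZL ballI, clarify)
    fix C \<xi> z \<eta> v assume C: "C \<in> wcomm H D M" and z: "(\<xi>, z) \<in> ?Z" and v: "(\<eta>, v) \<in> dag H D ?Z"
    obtain x where x: "(\<xi>, x) \<in> X2" "(x, z) \<in> ?A"
      using z by (auto simp: wmult_def)
    obtain u where u: "(\<eta>, u) \<in> dag H D X1" "(u, v) \<in> adj H X2"
      using v by (auto simp: dag_Z W_def)
    obtain B where B: "bop H B" and CB: "\<And>x y. x \<in> H \<Longrightarrow> y \<in> H \<Longrightarrow> cinner (C x) y = cinner x (B y)"
      using bop_adjoint_exists[OF H wcommD(1)[OF C]] by blast
    have BM: "B \<in> wcomm H D M"
      by (rule wcomm_adjoint[OF M C B CB])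
    have in_H: "x \<in> H" "z \<in> H" "\<eta> \<in> H" "u \<in> H"
      using x u A_sub LdagD(5)[OF XL(2)] adj_subset[of H X1] by (auto simp: in_dag_iff)
    have "cinner (C z) \<eta> = cinner z (B \<eta>)"
      by (rule CB[OF in_H(2,3)])
    also have "\<dots> = cinner x (B u)"
      by (rule adj_swap[OF x(2) wcomm_commutes[OF M BM inv[OF BM] Ostar_vsD(6)[OF M X(1)] u(1)]])
    also have "\<dots> = cinner (C x) u"
      by (rule CB[OF in_H(1,4), symmetric])
    also have "\<dots> = cinner (C \<xi>) v"
      by (rule adjD[OF u(2) wcomm_commutes[OF M C inv[OF C] X(2) x(1)]])
    finally show "cinner (C z) \<eta> = cinner (C \<xi>) v" .
  qed
  then show "?Z \<in> M" using bicomm by blast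
qed

subsection \<open>The full closure\<close>

text \<open>Closability of \<open>X\<close>: its closure sits inside a closed graph, which is an
  operator because \<open>dag H D X\<close> has dense domain.\<close>

lemma closure_subset_adj_dag:
  assumes "dense_subspace H D" "X \<in> Ldag H D"
  shows "closure X \<subseteq> adj H (dag H D X)"
  using subset_adj_dag[OF LdagD(5)[OF assms(2)]] dense_subspaceD(2)[OF assms(1)]
  by (intro closure_minimal closed_adj)

context
  fixes H D :: "'h::chilbert_space set" and M
  assumes M: "Ostar_vs H D M"
begin

definition hat_op :: "('h \<times> 'h) set \<Rightarrow> ('h \<times> 'h) set" where
  "hat_op X = closure X \<inter> (hatD M \<times> UNIV)"

private lemmas D = Ostar_vsD(1)[OF M]
private lemmas H = dense_subspaceD(1,2)[OF Ostar_vsD(1)[OF M]]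

private lemma in_Ldag: "X \<in> M \<Longrightarrow> X \<in> Ldag H D"
  using Ostar_vsD(2)[OF M] by blast

private lemma lin_op_adj_dag: "X \<in> M \<Longrightarrow> lin_op H (adj H (dag H D X))"
  using lin_op_adj[OF D] LdagD(2)[OF in_Ldag[OF Ostar_vsD(6)[OF M]]] by blast

lemma D_subset_hatD: "D \<subseteq> hatD M"
proof
  fix \<xi> assume "\<xi> \<in> D"
  then show "\<xi> \<in> hatD M"
    unfolding hatD_def using LdagD(2)[OF in_Ldag] closure_subset by blast
qed

lemma hatD_subset: "hatD M \<subseteq> H"
proof -
  obtain X where X: "X \<in> M" using Ostar_vsD(3)[OF M] by blast
  have "closure X \<subseteq> H \<times> H"
    using closure_subset_adj_dag[OF D in_Ldag[OF X]] adj_subset by blast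
  then show ?thesis using X by (auto simp: hatD_def)
qed

lemma dense_subspace_hatD: "dense_subspace H (hatD M)"
proof -
  have "csubspace (Domain (closure X))" if "X \<in> M" for X
    by (intro csubspace_Domain csubspace_closure LdagD(4)[OF in_Ldag[OF that]])
  then have "csubspace (hatD M)"
    unfolding hatD_def by (rule csubspace_INT)
  moreover have "H \<subseteq> closure (hatD M)"
    using dense_subspaceD(5)[OF D] closure_mono[OF D_subset_hatD] by blast
  ultimately show ?thesis
    using H hatD_subset by (auto simp: dense_subspace_def hilbert_carrier_def)
qed

lemma full_closure_eq: "full_closure M = hat_op ` M"
  by (auto simp: full_closure_def hat_op_def)

lemma subset_hat_op: "X \<in> M \<Longrightarrow> X \<subseteq> hat_op X"
  using closure_subset D_subset_hatD LdagD(2)[OF in_Ldag] by (fastforce simp: hat_op_def)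

lemma hat_op_subset: "hat_op X \<subseteq> closure X"
  by (auto simp: hat_op_def)

lemma Domain_hat_op:
  assumes "X \<in> M" shows "Domain (hat_op X) = hatD M"
proof -
  have "hatD M \<subseteq> Domain (closure X)"
    unfolding hatD_def using assms by blast
  then show ?thesis by (auto simp: hat_op_def)
qed

text \<open>The closure of \<open>X\<close> is already total on \<open>hatD M\<close>, and its
  extension \<open>adj H (dag H D X)\<close> is single-valued, so both agree there. Questions about
  closures thus become questions about adjoints.\<close>

lemma hat_op_eq_adj_dag:
  assumes "X \<in> M"
  shows "hat_op X = adj H (dag H D X) \<inter> (hatD M \<times> UNIV)"
proof (rule lin_op_eqI)
  show "lin_op H (adj H (dag H D X) \<inter> (hatD M \<times> UNIV))"
    using H(1) dense_subspaceD(3)[OF dense_subspace_hatD]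
    by (intro lin_op_subset[OF lin_op_adj_dag[OF assms]] csubspace_Int csubspace_adj csubspace_Times_UNIV) auto
  show "hat_op X \<subseteq> adj H (dag H D X) \<inter> (hatD M \<times> UNIV)"
    using closure_subset_adj_dag[OF D in_Ldag[OF assms]] by (auto simp: hat_op_def)
qed (use Domain_hat_op[OF assms] in auto)

lemma hat_op_eqI:
  assumes X: "X \<in> M" and Y: "Domain Y = hatD M" "Y \<subseteq> adj H (dag H D X)"
  shows "Y = hat_op X"
proof (rule lin_op_eqI)
  show "Y \<subseteq> hat_op X"
    using Y by (auto simp: hat_op_eq_adj_dag[OF X])
  show "lin_op H (hat_op X)"
    using csubspace_closure[OF LdagD(4)[OF in_Ldag[OF X]]] dense_subspaceD(3)[OF dense_subspace_hatD]
    by (intro lin_op_subset[OF lin_op_adj_dag[OF X]])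
      (auto simp: hat_op_eq_adj_dag[OF X] intro: csubspace_Int csubspace_adj[OF H(1)] csubspace_Times_UNIV)
qed (use Y Domain_hat_op[OF X] in auto)

lemma adj_hat_op: "X \<in> M \<Longrightarrow> adj H (hat_op X) = adj H X"
  by (intro adj_between_closure subset_hat_op hat_op_subset)

text \<open>An operator between \<open>X\<close> and its closure has the adjoint of
  \<open>X\<close>; restricted to \<open>hatD M\<close>, that adjoint is the formula of
  \<open>hat_op_eq_adj_dag\<close> for \<open>dag H D X\<close>.\<close>

lemma dag_hat_op:
  assumes X: "X \<in> M"
  shows "dag H (hatD M) (hat_op X) = hat_op (dag H D X)"
  unfolding dag_def[of H "hatD M"] adj_hat_op[OF X] hat_op_eq_adj_dag[OF Ostar_vsD(6)[OF M X]]
    dag_dag[OF D in_Ldag[OF X]] ..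

lemma hat_op_in_Ldag:
  assumes X: "X \<in> M"
  shows "hat_op X \<in> Ldag H (hatD M)"
proof (rule LdagI[OF dense_subspace_hatD])
  show "hat_op X \<subseteq> H \<times> H"
    using adj_subset by (auto simp: hat_op_eq_adj_dag[OF X])
  show "csubspace (hat_op X)"
    unfolding hat_op_def using dense_subspaceD(3)[OF dense_subspace_hatD]
    by (intro csubspace_Int csubspace_closure csubspace_Times_UNIV LdagD(4)[OF in_Ldag[OF X]])
  show "\<exists>y. (\<eta>, y) \<in> adj H (hat_op X)" if "\<eta> \<in> hatD M" for \<eta>
    using that Domain_hat_op[OF Ostar_vsD(6)[OF M X]] dag_hat_op[OF X] dag_subset_adj by blast
qed (rule Domain_hat_op[OF X])

lemma full_closure_Ostar_vs: "Ostar_vs H (hatD M) (full_closure M)"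
  unfolding Ostar_vs_def full_closure_eq
proof (intro conjI allI ballI dense_subspace_hatD)
  show "hat_op ` M \<subseteq> Ldag H (hatD M)" using hat_op_in_Ldag by blast
  show "hat_op ` M \<noteq> {}" using Ostar_vsD(3)[OF M] by blast
  show "dag H (hatD M) X \<in> hat_op ` M" if "X \<in> hat_op ` M" for X
    using that Ostar_vsD(6)[OF M] by (auto simp: dag_hat_op)
  show "op_add X' Y' \<in> hat_op ` M" if "X' \<in> hat_op ` M" "Y' \<in> hat_op ` M" for X' Y'
  proof -
    obtain X Y where X: "X \<in> M" and Y: "Y \<in> M" and [simp]: "X' = hat_op X" "Y' = hat_op Y"
      using \<open>X' \<in> hat_op ` M\<close> \<open>Y' \<in> hat_op ` M\<close> by blast
    note XY = Ostar_vsD(4)[OF M X Y]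
    \<comment> \<open>With this additivity, the sum of the extended operators lies in the adjoint of
      \<open>dag H D (op_add X Y)\<close>; its domain is \<open>hatD M\<close>, so it is the
      extension of the sum.\<close>
    have "dag H D (op_add X Y) = op_add (dag H D X) (dag H D Y)"
      using op_add_mono[OF dag_subset_adj dag_subset_adj] op_add_adj_subset[OF H(1)]
        LdagD(2)[OF in_Ldag[OF Ostar_vsD(6)[OF M X]]] LdagD(2)[OF in_Ldag[OF Ostar_vsD(6)[OF M Y]]]
      by (intro dag_eqI[OF D in_Ldag[OF XY]]) (blast, simp add: Domain_op_add)
    moreover have "op_add X' Y' \<subseteq> op_add (adj H (dag H D X)) (adj H (dag H D Y))"
      by (intro op_add_mono) (auto simp: hat_op_eq_adj_dag X Y)
    ultimately have "op_add X' Y' \<subseteq> adj H (dag H D (op_add X Y))"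
      using op_add_adj_subset[OF H(1), of "dag H D X" "dag H D Y"] by simp
    moreover have "Domain (op_add X' Y') = hatD M"
      by (simp add: Domain_op_add Domain_hat_op X Y)
    ultimately show ?thesis
      using hat_op_eqI[OF XY] XY by blast
  qed
  show "op_scale c X' \<in> hat_op ` M" if "X' \<in> hat_op ` M" for c X'
  proof -
    obtain X where X: "X \<in> M" and [simp]: "X' = hat_op X"
      using \<open>X' \<in> hat_op ` M\<close> by blast
    note cX = Ostar_vsD(5)[OF M X, of c]
    have "dag H D (op_scale c X) = op_scale (cnj c) (dag H D X)"
      using op_scale_mono[OF dag_subset_adj] op_scale_adj_subset[OF H(1)]
        LdagD(2)[OF in_Ldag[OF Ostar_vsD(6)[OF M X]]]
      by (intro dag_eqI[OF D in_Ldag[OF cX]]) (blast, simp add: Domain_op_scale)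
    moreover have "op_scale c X' \<subseteq> op_scale c (adj H (dag H D X))"
      by (intro op_scale_mono) (auto simp: hat_op_eq_adj_dag X)
    ultimately have "op_scale c X' \<subseteq> adj H (dag H D (op_scale c X))"
      using op_scale_adj_subset[OF H(1), of "cnj c" "dag H D X"] by simp
    moreover have "Domain (op_scale c X') = hatD M"
      by (simp add: Domain_op_scale Domain_hat_op X)
    ultimately show ?thesis
      using hat_op_eqI[OF cX] cX by blast
  qed
qed

text \<open>Extending \<open>X\<close> within its closure does not change that closure, so a second
  completion adds nothing to the domain.\<close>

lemma full_closure_fully_closed: "fully_closed (hatD M) (full_closure M)"
proof -
  have "closure (hat_op X) = closure X" if "X \<in> M" for X
    using closure_mono[OF subset_hat_op[OF that]] closure_mono[OF hat_op_subset[of X]] by simp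
  then show ?thesis
    unfolding fully_closed_def full_closure_eq by (simp add: hatD_def)
qed

text \<open>Pairs in the extended operator and in its \<open>dag\<close> are limits of pairs in
  \<open>X\<close> and \<open>dag H D X\<close>, and \<open>C\<close> is continuous. Hence
  commutants can be computed on the smaller domain.\<close>

lemma wcomm_full_closure: "wcomm H (hatD M) (full_closure M) = wcomm H D M"
proof
  show "wcomm H (hatD M) (full_closure M) \<subseteq> wcomm H D M"
  proof
    fix C assume C: "C \<in> wcomm H (hatD M) (full_closure M)"
    show "C \<in> wcomm H D M"
    proof (rule wcommI[OF wcommD(1)[OF C]])
      fix X \<xi> x \<eta> y assume X: "X \<in> M" and x: "(\<xi>, x) \<in> X" and y: "(\<eta>, y) \<in> dag H D X"
      show "cinner (C x) \<eta> = cinner (C \<xi>) y"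
      proof (rule wcommD(2)[OF C])
        show "hat_op X \<in> full_closure M" using X by (simp add: full_closure_eq)
        show "(\<xi>, x) \<in> hat_op X" using subset_hat_op[OF X] x by blast
        show "(\<eta>, y) \<in> dag H (hatD M) (hat_op X)"
          using subset_hat_op[OF Ostar_vsD(6)[OF M X]] y by (auto simp: dag_hat_op[OF X])
      qed
    qed
  qed
  show "wcomm H D M \<subseteq> wcomm H (hatD M) (full_closure M)"
  proof
    fix C assume C: "C \<in> wcomm H D M"
    note bC = wcommD(1)[OF C]
    show "C \<in> wcomm H (hatD M) (full_closure M)"
    proof (rule wcommI[OF bC])
      fix X' \<xi> x \<eta> y
      assume X': "X' \<in> full_closure M" and x: "(\<xi>, x) \<in> X'" and y: "(\<eta>, y) \<in> dag H (hatD M) X'"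
      obtain X where X: "X \<in> M" and [simp]: "X' = hat_op X"
        using X' by (auto simp: full_closure_eq)
      have "(\<xi>, x) \<in> closure X" "(\<eta>, y) \<in> closure (dag H D X)"
        using x y dag_hat_op[OF X] hat_op_subset by auto
      then obtain f g where f: "\<And>n. f n \<in> X" "f \<longlonglongrightarrow> (\<xi>, x)"
        and g: "\<And>n. g n \<in> dag H D X" "g \<longlonglongrightarrow> (\<eta>, y)"
        unfolding closure_sequential by blast
      have f': "(\<lambda>n. fst (f n)) \<longlonglongrightarrow> \<xi>" "(\<lambda>n. snd (f n)) \<longlonglongrightarrow> x"
        using tendsto_fst[OF f(2)] tendsto_snd[OF f(2)] by simp_all
      have g': "(\<lambda>n. fst (g n)) \<longlonglongrightarrow> \<eta>" "(\<lambda>n. snd (g n)) \<longlonglongrightarrow> y"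
        using tendsto_fst[OF g(2)] tendsto_snd[OF g(2)] by simp_all
      have fH: "fst (f n) \<in> H" "snd (f n) \<in> H" for n
        using f(1)[of n] LdagD(5)[OF in_Ldag[OF X]] by auto
      have "(\<lambda>n. cinner (C (snd (f n))) (fst (g n))) \<longlonglongrightarrow> cinner (C x) \<eta>"
        by (intro tendsto_intros g' bop_tendsto[OF H bC] fH f')
      moreover have "(\<lambda>n. cinner (C (fst (f n))) (snd (g n))) \<longlonglongrightarrow> cinner (C \<xi>) y"
        by (intro tendsto_intros g' bop_tendsto[OF H bC] fH f')
      moreover have "cinner (C (snd (f n))) (fst (g n)) = cinner (C (fst (f n))) (snd (g n))" for n
        using wcommD(2)[OF C X, of "fst (f n)" "snd (f n)" "fst (g n)" "snd (g n)"] f(1) g(1) by simp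
      ultimately show "cinner (C x) \<eta> = cinner (C \<xi>) y"
        using LIMSEQ_unique by simp
    qed
  qed
qed

end

subsection \<open>Reduction by a projection\<close>

lemma in_op_of_fun_iff: "(\<xi>, x) \<in> op_of_fun D A \<longleftrightarrow> \<xi> \<in> D \<and> x = A \<xi>"
  by (auto simp: op_of_fun_def)

lemma in_reduce_iff: "(\<xi>, z) \<in> reduce E D X \<longleftrightarrow> \<xi> \<in> E ` D \<and> (\<exists>x. (\<xi>, x) \<in> X \<and> z = E x)"
  by (auto simp: reduce_def)

context
  fixes M :: "('h::chilbert_space \<times> 'h) set set" and D :: "'h set" and E :: "'h \<Rightarrow> 'h"
  assumes GW: "partial_GW UNIV D M"
    and proj: "is_proj E"
    and E_in_M: "op_of_fun D E \<in> M"
    and E_D: "E ` D \<subseteq> D"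
begin

private abbreviation (input) "N \<equiv> wcomm UNIV D M"
private abbreviation (input) "H \<equiv> range E"
private abbreviation (input) "ME \<equiv> reduce E D ` M"
private abbreviation (input) "commutes_N A \<equiv> \<forall>C\<in>N. \<forall>x. C (A x) = A (C x)"

private lemma Ostar_vs_M: "Ostar_vs UNIV D M"
  using GW by (auto simp: partial_GW_def partial_Oalg_def)

private lemmas dense_D = Ostar_vsD(1)[OF Ostar_vs_M]

private lemma M_in_Ldag: "X \<in> M \<Longrightarrow> X \<in> Ldag UNIV D"
  using Ostar_vsD(2)[OF Ostar_vs_M] by blast

private lemma in_M_if_wbicomm: "X \<in> wbicomm UNIV D M \<Longrightarrow> X \<in> M"
  using GW by (auto simp: partial_GW_def)

private lemma N_invariant: "C \<in> N \<Longrightarrow> C ` D \<subseteq> D"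
  using GW by (auto simp: partial_GW_def)

private lemma E_idem: "E (E x) = E x" and E_sym: "cinner (E x) y = cinner x (E y)"
  and E_bop: "bop UNIV E"
  using proj by (auto simp: is_proj_def)

private lemma cinner_E_right: "E x = x \<Longrightarrow> cinner x (E y) = cinner x y"
  and cinner_E_left: "E y = y \<Longrightarrow> cinner (E x) y = cinner x y"
  using E_sym[of x y] by (simp_all add: E_sym)

private lemma csubspace_UNIV: "csubspace (UNIV :: 'h set)"
  by (simp add: csubspace_def)

private lemmas E_add = bop_add[OF E_bop UNIV_I UNIV_I]
private lemmas E_scaleC = bop_scaleC[OF E_bop UNIV_I]

private lemma E_tendsto: "f \<longlonglongrightarrow> x \<Longrightarrow> (\<lambda>n. E (f n)) \<longlonglongrightarrow> E x"
  by (rule bop_tendsto[OF csubspace_UNIV closed_UNIV E_bop]) auto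

private lemma in_H_iff: "x \<in> H \<longleftrightarrow> E x = x"
  using E_idem by (metis rangeE rangeI)

private lemma E_0: "E 0 = 0"
  using E_add[of 0 0] by simp

private lemma csubspace_H: "csubspace H"
  unfolding csubspace_def by (simp add: in_H_iff E_add E_scaleC E_0)

private lemma closed_H: "closed H"
  unfolding closed_sequential_limits
proof clarify
  fix f l assume f: "\<forall>n. f n \<in> H" "f \<longlonglongrightarrow> l"
  then have "(\<lambda>n. E (f n)) = f" by (auto simp: in_H_iff)
  then have "f \<longlonglongrightarrow> E l" using E_tendsto[OF f(2)] by simp
  then show "l \<in> H"
    using LIMSEQ_unique[OF _ f(2)] in_H_iff by blast
qed

private lemma E_on_ED: "\<xi> \<in> E ` D \<Longrightarrow> E \<xi> = \<xi>"
  using E_idem by auto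

private lemma approx_in_D:
  obtains f where "\<And>n. f n \<in> D" "f \<longlonglongrightarrow> x"
proof -
  have "x \<in> closure D" using dense_subspaceD(5)[OF dense_D] by blast
  then show thesis using that unfolding closure_sequential by blast
qed

private lemma dense_ED: "dense_subspace H (E ` D)"
  unfolding dense_subspace_def hilbert_carrier_def
proof (intro conjI csubspace_H closed_H)
  show "csubspace (E ` D)"
    using dense_subspaceD(3)[OF dense_D] unfolding csubspace_def
    by (auto simp flip: E_add E_scaleC) (metis E_0 imageI)
  show "H \<subseteq> closure (E ` D)"
  proof
    fix x assume "x \<in> H"
    then have x: "E x = x" by (simp add: in_H_iff)
    obtain f where "\<And>n. f n \<in> D" "f \<longlonglongrightarrow> x"
      using approx_in_D[where x = x] by blast
    then show "x \<in> closure (E ` D)"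
      unfolding closure_sequential using E_tendsto[of f x] x by (intro exI[of _ "\<lambda>n. E (f n)"]) auto
  qed
qed auto

private lemma N_bop: "C \<in> N \<Longrightarrow> bop UNIV C"
  by (rule wcommD(1))

private lemma N_tendsto: "C \<in> N \<Longrightarrow> f \<longlonglongrightarrow> x \<Longrightarrow> (\<lambda>n. C (f n)) \<longlonglongrightarrow> C x"
  by (rule bop_tendsto[OF csubspace_UNIV closed_UNIV N_bop]) auto

private lemma cinner_eq_on_D: "(\<And>\<eta>. \<eta> \<in> D \<Longrightarrow> cinner x \<eta> = cinner y \<eta>) \<Longrightarrow> x = y"
  by (rule cinner_eq_on_dense[OF csubspace_UNIV dense_subspaceD(5)[OF dense_D]]) auto

text \<open>On \<open>D\<close> the restriction of \<open>E\<close> is its own \<open>dag\<close>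
  and belongs to \<open>M\<close>, so weak commutation gives the identity there; density and
  continuity extend it.\<close>

private lemma N_commutes_E:
  assumes C: "C \<in> N"
  shows "C (E x) = E (C x)"
proof -
  have on_D: "C (E \<xi>) = E (C \<xi>)" if \<xi>: "\<xi> \<in> D" for \<xi>
  proof (rule cinner_eq_on_D)
    fix \<eta> assume \<eta>: "\<eta> \<in> D"
    then have "(\<eta>, E \<eta>) \<in> dag UNIV D (op_of_fun D E)"
      by (auto simp: in_dag_iff in_op_of_fun_iff E_sym intro!: adjI)
    then have "cinner (C (E \<xi>)) \<eta> = cinner (C \<xi>) (E \<eta>)"
      using \<xi> by (intro wcommD(2)[OF C E_in_M]) (auto simp: in_op_of_fun_iff)
    then show "cinner (C (E \<xi>)) \<eta> = cinner (E (C \<xi>)) \<eta>"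
      by (simp add: E_sym)
  qed
  obtain f where f: "\<And>n. f n \<in> D" "f \<longlonglongrightarrow> x"
    using approx_in_D[where x = x] by blast
  have "(\<lambda>n. C (E (f n))) \<longlonglongrightarrow> C (E x)" "(\<lambda>n. E (C (f n))) \<longlonglongrightarrow> E (C x)"
    using N_tendsto[OF C E_tendsto[OF f(2)]] E_tendsto[OF N_tendsto[OF C f(2)]] .
  then show ?thesis
    unfolding on_D[OF f(1)] by (rule LIMSEQ_unique)
qed

private lemma N_adjoint:
  assumes C: "C \<in> N"
  obtains B where "B \<in> N" "\<And>x y. cinner (C x) y = cinner x (B y)"
  using bop_adjoint_exists[OF csubspace_UNIV closed_UNIV N_bop[OF C]] wcomm_adjoint[OF Ostar_vs_M C]
  by (metis UNIV_I)

text \<open>A source of elements of \<open>M\<close>: bounded operators commuting with the weak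
  commutant satisfy the bicommutant condition on \<open>D\<close>. Their values may leave
  \<open>D\<close>, as is allowed in \<open>Ldag\<close>.\<close>

private lemma
  assumes A: "bop UNIV A" "commutes_N A" and B: "\<And>x y. cinner (A x) y = cinner x (B y)"
  shows op_of_fun_in_M: "op_of_fun D A \<in> M"
    and dag_op_of_fun: "dag UNIV D (op_of_fun D A) = op_of_fun D B"
proof -
  have adj: "op_of_fun D B \<subseteq> adj UNIV (op_of_fun D A)"
    by (auto simp: in_op_of_fun_iff B intro!: adjI)
  have L: "op_of_fun D A \<in> Ldag UNIV D"
  proof (rule LdagI[OF dense_D])
    show "csubspace (op_of_fun D A)"
      using dense_subspaceD(3)[OF dense_D] bop_add[OF A(1), of 0 0]
      unfolding csubspace_def zero_prod_def
      by (auto simp: in_op_of_fun_iff bop_add[OF A(1)] bop_scaleC[OF A(1)])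
    show "Domain (op_of_fun D A) = D"
      by (auto simp: in_op_of_fun_iff)
    show "\<exists>y. (\<eta>, y) \<in> adj UNIV (op_of_fun D A)" if "\<eta> \<in> D" for \<eta>
      using adj that in_op_of_fun_iff[of \<eta> "B \<eta>" D B] by blast
  qed simp
  show dag: "dag UNIV D (op_of_fun D A) = op_of_fun D B"
    by (rule dag_eqI[OF dense_D L adj]) (auto simp: in_op_of_fun_iff)
  have "op_of_fun D A \<in> wbicomm UNIV D M"
    unfolding wbicomm_def using L A(2) by (auto simp: dag in_op_of_fun_iff B)
  then show "op_of_fun D A \<in> M"
    by (rule in_M_if_wbicomm)
qed

section \<open>Compression of operators to the range of \<open>E\<close>\<close>

private lemma Domain_reduce:
  assumes X: "X \<in> M" shows "Domain (reduce E D X) = E ` D"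
proof (intro equalityI subsetI)
  fix \<xi> assume \<xi>: "\<xi> \<in> E ` D"
  then obtain x where "(\<xi>, x) \<in> X"
    using LdagD(2)[OF M_in_Ldag[OF X]] E_D by blast
  with \<xi> have "(\<xi>, E x) \<in> reduce E D X"
    by (auto simp: in_reduce_iff)
  then show "\<xi> \<in> Domain (reduce E D X)" by (rule DomainI)
qed (auto simp: in_reduce_iff)

private lemma reduce_dag_subset_adj: "reduce E D (dag UNIV D X) \<subseteq> adj H (reduce E D X)"
proof clarify
  fix \<eta> z assume "(\<eta>, z) \<in> reduce E D (dag UNIV D X)"
  then obtain y where \<eta>: "\<eta> \<in> E ` D" and y: "(\<eta>, y) \<in> adj UNIV X" and [simp]: "z = E y"
    by (auto simp: in_reduce_iff in_dag_iff)
  show "(\<eta>, z) \<in> adj H (reduce E D X)"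
  proof (rule adjI)
    fix \<xi> w assume "(\<xi>, w) \<in> reduce E D X"
    then obtain x where \<xi>: "\<xi> \<in> E ` D" and x: "(\<xi>, x) \<in> X" and [simp]: "w = E x"
      by (auto simp: in_reduce_iff)
    show "cinner w \<eta> = cinner \<xi> z"
      using adjD[OF y x] by (simp add: cinner_E_right[OF E_on_ED[OF \<xi>]] cinner_E_left[OF E_on_ED[OF \<eta>]])
  qed (use \<eta> in auto)
qed

private lemma reduce_in_Ldag:
  assumes X: "X \<in> M"
  shows "reduce E D X \<in> Ldag H (E ` D)"
proof (rule LdagI[OF dense_ED])
  show "reduce E D X \<subseteq> H \<times> H"
    by (auto simp: in_reduce_iff)
  have "reduce E D X = (X O op_of_fun UNIV E) \<inter> (E ` D \<times> UNIV)"
    by (auto simp: reduce_def op_of_fun_def)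
  moreover have "csubspace (op_of_fun UNIV E)"
    unfolding csubspace_def zero_prod_def by (auto simp: in_op_of_fun_iff E_add E_scaleC E_0)
  ultimately show "csubspace (reduce E D X)"
    using LdagD(4)[OF M_in_Ldag[OF X]] dense_subspaceD(3)[OF dense_ED]
    by (simp add: csubspace_Int csubspace_relcomp csubspace_Times_UNIV)
  show "\<exists>y. (\<eta>, y) \<in> adj H (reduce E D X)" if "\<eta> \<in> E ` D" for \<eta>
    using that Domain_reduce[OF Ostar_vsD(6)[OF Ostar_vs_M X]] reduce_dag_subset_adj[of X] by blast
qed (rule Domain_reduce[OF X])

private lemma dag_reduce:
  "X \<in> M \<Longrightarrow> dag H (E ` D) (reduce E D X) = reduce E D (dag UNIV D X)"
  by (intro dag_eqI[OF dense_ED] reduce_in_Ldag reduce_dag_subset_adj Domain_reduce Ostar_vsD(6)[OF Ostar_vs_M])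

private lemma op_add_reduce: "op_add (reduce E D X) (reduce E D Y) = reduce E D (op_add X Y)"
proof (intro equalityI subrelI)
  fix \<xi> z assume "(\<xi>, z) \<in> op_add (reduce E D X) (reduce E D Y)"
  then obtain x y where "\<xi> \<in> E ` D" "(\<xi>, x) \<in> X" "(\<xi>, y) \<in> Y" "z = E (x + y)"
    unfolding op_add_def in_reduce_iff E_add by blast
  moreover from this have "(\<xi>, x + y) \<in> op_add X Y"
    unfolding op_add_def by blast
  ultimately show "(\<xi>, z) \<in> reduce E D (op_add X Y)"
    unfolding in_reduce_iff by blast
next
  fix \<xi> z assume "(\<xi>, z) \<in> reduce E D (op_add X Y)"
  then obtain x y where "\<xi> \<in> E ` D" "(\<xi>, x) \<in> X" "(\<xi>, y) \<in> Y" "z = E x + E y"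
    unfolding op_add_def in_reduce_iff by (auto simp: E_add)
  then show "(\<xi>, z) \<in> op_add (reduce E D X) (reduce E D Y)"
    unfolding op_add_def in_reduce_iff by blast
qed

private lemma op_scale_reduce: "op_scale c (reduce E D X) = reduce E D (op_scale c X)"
proof (intro equalityI subrelI)
  fix \<xi> z assume "(\<xi>, z) \<in> op_scale c (reduce E D X)"
  then obtain x where "\<xi> \<in> E ` D" "(\<xi>, x) \<in> X" "z = E (scaleC c x)"
    unfolding op_scale_def in_reduce_iff E_scaleC by blast
  moreover from this have "(\<xi>, scaleC c x) \<in> op_scale c X"
    unfolding op_scale_def by blast
  ultimately show "(\<xi>, z) \<in> reduce E D (op_scale c X)"
    unfolding in_reduce_iff by blast
next
  fix \<xi> z assume "(\<xi>, z) \<in> reduce E D (op_scale c X)"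
  then obtain x where "\<xi> \<in> E ` D" "(\<xi>, x) \<in> X" "z = scaleC c (E x)"
    unfolding op_scale_def in_reduce_iff by (auto simp: E_scaleC)
  then show "(\<xi>, z) \<in> op_scale c (reduce E D X)"
    unfolding op_scale_def in_reduce_iff by blast
qed

private lemma Ostar_vs_ME: "Ostar_vs H (E ` D) ME"
  unfolding Ostar_vs_def
proof (intro conjI allI ballI dense_ED)
  show "ME \<subseteq> Ldag H (E ` D)" using reduce_in_Ldag by blast
  show "ME \<noteq> {}" using E_in_M by blast
  show "op_add X Y \<in> ME" if "X \<in> ME" "Y \<in> ME" for X Y
    using that Ostar_vsD(4)[OF Ostar_vs_M] by (auto simp: op_add_reduce)
  show "op_scale c X \<in> ME" if "X \<in> ME" for c X
    using that Ostar_vsD(5)[OF Ostar_vs_M] by (auto simp: op_scale_reduce)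
  show "dag H (E ` D) X \<in> ME" if "X \<in> ME" for X
    using that Ostar_vsD(6)[OF Ostar_vs_M] by (auto simp: dag_reduce)
qed

text \<open>As \<open>C\<close> commutes with \<open>E\<close>, it leaves the range of
  \<open>E\<close> invariant and \<open>E\<close> can be inserted or dropped in the relation for
  \<open>X\<close>. Outside the range the value is 0, as \<open>bop\<close> requires.\<close>

private lemma N_reduced_in_wcomm:
  assumes C: "C \<in> N"
  shows "(\<lambda>x. if x \<in> H then C x else 0) \<in> wcomm H (E ` D) ME"
proof (rule wcommI)
  have C_H: "C x \<in> H" if "x \<in> H" for x
    using that N_commutes_E[OF C, of x] by (simp add: in_H_iff)
  then show "bop H (\<lambda>x. if x \<in> H then C x else 0)"
    using N_bop[OF C] csubspace_H unfolding bop_def csubspace_def by auto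
  fix X' \<xi> x' \<eta> y'
  assume "X' \<in> ME" and x': "(\<xi>, x') \<in> X'" and y': "(\<eta>, y') \<in> dag H (E ` D) X'"
  then obtain X where X: "X \<in> M" and X': "X' = reduce E D X" by blast
  obtain x where \<xi>: "\<xi> \<in> E ` D" and x: "(\<xi>, x) \<in> X" and [simp]: "x' = E x"
    using x' by (auto simp: X' in_reduce_iff)
  obtain y where \<eta>: "\<eta> \<in> E ` D" and y: "(\<eta>, y) \<in> dag UNIV D X" and [simp]: "y' = E y"
    using y' by (auto simp: X' dag_reduce[OF X] in_reduce_iff)
  have "cinner (C (E x)) \<eta> = cinner (C x) \<eta>"
    by (simp add: N_commutes_E[OF C] cinner_E_left[OF E_on_ED[OF \<eta>]])
  also have "\<dots> = cinner (C \<xi>) y"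
    by (rule wcommD(2)[OF C X x y])
  also have "\<dots> = cinner (C \<xi>) (E y)"
    using N_commutes_E[OF C, of \<xi>] by (simp add: cinner_E_right E_on_ED[OF \<xi>])
  finally show "cinner (if x' \<in> H then C x' else 0) \<eta> = cinner (if \<xi> \<in> H then C \<xi> else 0) y'"
    using \<xi> by auto
qed

text \<open>\<open>C\<close> commutes strongly with \<open>X\<close> and with \<open>E\<close>, so
  acting on both coordinates it maps the reduced graph into itself; continuity passes this to the
  closure.\<close>

private lemma N_preserves_reduce_closure:
  assumes C: "C \<in> N" and X: "X \<in> M" and p: "(\<xi>, z) \<in> closure (reduce E D X)"
  shows "(C \<xi>, C z) \<in> closure (reduce E D X)"
proof -
  have graph: "(C (fst p), C (snd p)) \<in> reduce E D X" if "p \<in> reduce E D X" for p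
  proof -
    obtain \<xi> x where \<xi>: "\<xi> \<in> E ` D" and x: "(\<xi>, x) \<in> X" and [simp]: "p = (\<xi>, E x)"
      using \<open>p \<in> reduce E D X\<close> by (cases p) (auto simp: in_reduce_iff)
    have "(C \<xi>, C x) \<in> X"
      by (rule wcomm_commutes[OF Ostar_vs_M C N_invariant[OF C] X x])
    moreover have "C \<xi> \<in> E ` D"
      using \<xi> N_invariant[OF C] by (auto simp: N_commutes_E[OF C])
    ultimately show ?thesis
      by (auto simp: in_reduce_iff N_commutes_E[OF C])
  qed
  obtain f where f: "\<And>n. f n \<in> reduce E D X" "f \<longlonglongrightarrow> (\<xi>, z)"
    using p unfolding closure_sequential by blast
  have "(\<lambda>n. (C (fst (f n)), C (snd (f n)))) \<longlonglongrightarrow> (C \<xi>, C z)"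
    using tendsto_fst[OF f(2)] tendsto_snd[OF f(2)]
    by (intro tendsto_Pair N_tendsto[OF C]) auto
  then show ?thesis
    unfolding closure_sequential using graph[OF f(1)]
    by (intro exI[of _ "\<lambda>n. (C (fst (f n)), C (snd (f n)))"]) simp
qed

private lemma wcomm_reduced_commutes:
  assumes T: "T \<in> wcomm H (E ` D) ME" and A: "bop UNIV A" "commutes_N A" and x: "x \<in> H"
  shows "T (E (A x)) = E (A (T x))"
proof -
  note T_bop = wcommD(1)[OF T]
  obtain B where B: "\<And>x y. cinner (A x) y = cinner x (B y)"
    using bop_adjoint_exists[OF csubspace_UNIV closed_UNIV A(1)] by (metis UNIV_I)
  have on_ED: "T (E (A \<xi>)) = E (A (T \<xi>))" if \<xi>: "\<xi> \<in> E ` D" for \<xi>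
  proof (rule cinner_eq_on_dense[OF csubspace_H dense_subspaceD(5)[OF dense_ED]])
    show "T (E (A \<xi>)) \<in> H" by (rule bop_range[OF T_bop]) simp
    fix \<eta> assume \<eta>: "\<eta> \<in> E ` D"
    have T\<xi>: "E (T \<xi>) = T \<xi>"
      using bop_range[OF T_bop, of \<xi>] \<xi> in_H_iff by blast
    have "cinner (T (E (A \<xi>))) \<eta> = cinner (T \<xi>) (E (B \<eta>))"
    proof (rule wcommD(2)[OF T])
      show "reduce E D (op_of_fun D A) \<in> ME"
        using op_of_fun_in_M[OF A B] by blast
      show "(\<xi>, E (A \<xi>)) \<in> reduce E D (op_of_fun D A)"
        using \<xi> E_D by (auto simp: in_reduce_iff in_op_of_fun_iff)
      show "(\<eta>, E (B \<eta>)) \<in> dag H (E ` D) (reduce E D (op_of_fun D A))"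
        using \<eta> E_D
        by (auto simp: dag_reduce[OF op_of_fun_in_M[OF A B]] dag_op_of_fun[OF A B] in_reduce_iff in_op_of_fun_iff)
    qed
    also have "\<dots> = cinner (T \<xi>) (B \<eta>)"
      by (rule cinner_E_right[OF T\<xi>])
    also have "\<dots> = cinner (E (A (T \<xi>))) \<eta>"
      by (simp add: cinner_E_left[OF E_on_ED[OF \<eta>]] B)
    finally show "cinner (T (E (A \<xi>))) \<eta> = cinner (E (A (T \<xi>))) \<eta>" .
  qed simp
  have "x \<in> closure (E ` D)"
    using x dense_subspaceD(5)[OF dense_ED] by blast
  then obtain f where f: "\<And>n. f n \<in> E ` D" "f \<longlonglongrightarrow> x"
    unfolding closure_sequential by blast
  have fH: "f n \<in> H" for n using f(1)[of n] by blast
  note A_tendsto = bop_tendsto[OF csubspace_UNIV closed_UNIV A(1) UNIV_I]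
  have "(\<lambda>n. T (E (A (f n)))) \<longlonglongrightarrow> T (E (A x))"
    by (intro bop_tendsto[OF csubspace_H closed_H T_bop] E_tendsto A_tendsto f) simp
  moreover have "(\<lambda>n. E (A (T (f n)))) \<longlonglongrightarrow> E (A (T x))"
    by (intro bop_tendsto[OF csubspace_H closed_H T_bop] E_tendsto A_tendsto f fH)
  ultimately show ?thesis
    unfolding on_ED[OF f(1)] by (rule LIMSEQ_unique)
qed

private lemma wcomm_reduced_preserves_closure:
  assumes T: "T \<in> wcomm H (E ` D) ME" and X: "X \<in> M" and p: "(\<xi>, z) \<in> closure (reduce E D X)"
  shows "(T \<xi>, T z) \<in> closure (reduce E D X)"
proof -
  define S where "S = closure (reduce E D X)"
  have S: "csubspace S" "closed S"
    unfolding S_def using csubspace_closure[OF LdagD(4)[OF reduce_in_Ldag[OF X]]] by auto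
  have "S \<subseteq> H \<times> H"
    unfolding S_def using LdagD(5)[OF reduce_in_Ldag[OF X]] closed_H
    by (intro closure_minimal closed_Times)
  then have S_H: "fst q \<in> H" "snd q \<in> H" if "q \<in> S" for q
    using that by auto
  \<comment> \<open>Both \<open>C\<close> and its adjoint \<open>B\<close> preserve
    \<open>S\<close>. Moving \<open>C\<close> onto \<open>s\<close> as \<open>B\<close> therefore
    shows that the transformed residual is still orthogonal to \<open>S\<close>.\<close>
  have commutes_N: "cproj S (C a, C b) = (C (fst (cproj S (a, b))), C (snd (cproj S (a, b))))"
    if C: "C \<in> N" for C a b
  proof (rule cproj_eqI[OF S])
    let ?p = "cproj S (a, b)"
    show "(C (fst ?p), C (snd ?p)) \<in> S"
      using N_preserves_reduce_closure[OF C X] cproj_in[OF S, of "(a, b)"] by (simp add: S_def)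
    fix s assume s: "s \<in> S"
    obtain B where B: "B \<in> N" and CB: "\<And>x y. cinner (C x) y = cinner x (B y)"
      using N_adjoint[OF C] by blast
    have BC: "cinner u (C w) = cinner (B u) w" for u w
      using CB[of w u] cinner_commute[of u "C w"] cinner_commute[of "B u" w] by simp
    have "(B (fst s), B (snd s)) \<in> S"
      using N_preserves_reduce_closure[OF B X] s by (simp add: S_def)
    then have "cinner (B (fst s), B (snd s)) ((a, b) - ?p) = 0"
      by (rule cproj_orth[OF S])
    then show "cinner s ((C a, C b) - (C (fst ?p), C (snd ?p))) = 0"
      by (simp add: cinner_prod_def cinner_diff_right BC)
  qed
  \<comment> \<open>\<open>\<pi>\<close> selects the output and \<open>\<iota>\<close> the input
    coordinate, so all four matrix entries of the projection are treated at once.\<close>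
  have entry: "T (\<pi> (cproj S (\<iota> x))) = \<pi> (cproj S (\<iota> (T x)))"
    if \<pi>: "\<pi> = fst \<or> \<pi> = snd" and \<iota>: "\<iota> = (\<lambda>x. (x, 0)) \<or> \<iota> = (\<lambda>x. (0, x))" and x: "x \<in> H"
    for \<pi> \<iota> x
  proof -
    define A where "A x = \<pi> (cproj S (\<iota> x))" for x
    have \<iota>_add: "\<iota> (x + y) = \<iota> x + \<iota> y" and \<iota>_scaleC: "\<iota> (scaleC c x) = scaleC c (\<iota> x)" for x y c
      using \<iota> by auto
    have \<pi>_add: "\<pi> (p + q) = \<pi> p + \<pi> q" and \<pi>_scaleC: "\<pi> (scaleC c p) = scaleC c (\<pi> p)" for p q c
      using \<pi> by (auto simp: scaleC_prod_def)
    have "norm (A x) \<le> 1 * norm x" for x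
    proof -
      have "norm (A x) \<le> norm (cproj S (\<iota> x))"
        using \<pi> norm_fst_le norm_snd_le by (cases "cproj S (\<iota> x)") (auto simp: A_def)
      also have "\<dots> \<le> norm (\<iota> x)"
        by (rule norm_cproj_le[OF S])
      also have "\<dots> = 1 * norm x"
        using \<iota> by (auto simp: norm_Pair)
      finally show ?thesis .
    qed
    then have "\<exists>K. \<forall>x\<in>UNIV. norm (A x) \<le> K * norm x"
      by blast
    then have "bop UNIV A"
      unfolding bop_def
      by (auto simp: A_def \<iota>_add \<iota>_scaleC \<pi>_add \<pi>_scaleC cproj_add[OF S] cproj_scaleC[OF S])
    moreover have "commutes_N A"
    proof (intro ballI allI)
      fix C x assume C: "C \<in> N"
      have "C 0 = 0" using bop_add[OF N_bop[OF C], of 0 0] by simp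
      then show "C (A x) = A (C x)"
        using \<pi> \<iota> commutes_N[OF C, of x 0] commutes_N[OF C, of 0 x] by (auto simp: A_def)
    qed
    \<comment> \<open>\<open>S\<close> consists of pairs from the range of \<open>E\<close>, so the
      compressions by \<open>E\<close> in \<open>wcomm_reduced_commutes\<close> disappear.\<close>
    moreover have "E (A y) = A y" for y
      using \<pi> S_H[OF cproj_in[OF S], of "\<iota> y"] by (auto simp: A_def in_H_iff)
    ultimately show ?thesis
      using wcomm_reduced_commutes[OF T _ _ x, of A] by (simp add: A_def)
  qed
  have pS: "(\<xi>, z) \<in> S" and "\<xi> \<in> H" "z \<in> H"
    using p S_H[of "(\<xi>, z)"] by (auto simp: S_def)
  have split: "cproj S (a, b) = cproj S (a, 0) + cproj S (0, b)" for a b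
    using cproj_add[OF S, of "(a, 0)" "(0, b)"] by simp
  \<comment> \<open>Summing the entries, \<open>T\<close> on both coordinates commutes with the
    projection at \<open>(\<xi>, z)\<close>. That pair is fixed by the projection, hence so is its
    image, which therefore lies in \<open>S\<close>.\<close>
  have T_comp: "\<pi> (cproj S (T \<xi>, T z)) = T (\<pi> (\<xi>, z))" if \<pi>: "\<pi> = fst \<or> \<pi> = snd" for \<pi>
  proof -
    have \<pi>_add: "\<pi> (p + q) = \<pi> p + \<pi> q" for p q using \<pi> by auto
    have \<pi>_H: "\<pi> (cproj S q) \<in> H" for q
      using \<pi> S_H[OF cproj_in[OF S], of q] by auto
    have "\<pi> (cproj S (T \<xi>, T z)) = T (\<pi> (cproj S (\<xi>, 0))) + T (\<pi> (cproj S (0, z)))"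
      using entry[OF \<pi>, of "\<lambda>x. (x, 0)" \<xi>] entry[OF \<pi>, of "\<lambda>x. (0, x)" z] \<open>\<xi> \<in> H\<close> \<open>z \<in> H\<close>
      by (simp add: split[of "T \<xi>" "T z"] \<pi>_add)
    also have "\<dots> = T (\<pi> (cproj S (\<xi>, z)))"
      by (simp only: split[of \<xi> z] \<pi>_add bop_add[OF wcommD(1)[OF T] \<pi>_H \<pi>_H])
    finally show ?thesis
      by (simp only: cproj_ident[OF S pS])
  qed
  have "cproj S (T \<xi>, T z) = (T \<xi>, T z)"
    using T_comp[of fst] T_comp[of snd] by (simp add: prod_eq_iff)
  then show ?thesis
    using cproj_in[OF S, of "(T \<xi>, T z)"] by (simp add: S_def)
qed

text \<open>\<open>T\<close> preserves the domain of each closed reduced graph, and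
  \<open>hatD\<close> is their intersection.\<close>

private lemma wcomm_reduced_invariant:
  assumes T: "T \<in> wcomm H (hatD ME) (full_closure ME)"
  shows "T ` hatD ME \<subseteq> hatD ME"
proof -
  have T': "T \<in> wcomm H (E ` D) ME"
    using T wcomm_full_closure[OF Ostar_vs_ME] by simp
  show ?thesis
    unfolding hatD_def using wcomm_reduced_preserves_closure[OF T'] by blast
qed

private lemma full_closure_bicommutant:
  "full_closure ME = wbicomm H (hatD ME) (full_closure ME)"
proof
  note F = full_closure_Ostar_vs[OF Ostar_vs_ME]
  note HD = dense_subspace_hatD[OF Ostar_vs_ME]
  show "full_closure ME \<subseteq> wbicomm H (hatD ME) (full_closure ME)"
    unfolding wbicomm_def using Ostar_vsD(2)[OF F] by (auto dest: wcommD(2))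
  show "wbicomm H (hatD ME) (full_closure ME) \<subseteq> full_closure ME"
  proof
    fix Y assume Y: "Y \<in> wbicomm H (hatD ME) (full_closure ME)"
    then have YL: "Y \<in> Ldag H (hatD ME)"
      by (simp add: wbicomm_def)
    let ?Y' = "dag H (hatD ME) Y"
    have Y'L: "?Y' \<in> Ldag H (hatD ME)"
      by (rule dag_in_Ldag[OF HD YL])
    \<comment> \<open>\<open>Y\<close> is tested against the restriction of \<open>C\<close> to the
      range of \<open>E\<close>, which lies in the weak commutant of the full closure.\<close>
    have Y_comm: "cinner (C y) (E \<eta>) = cinner (C (E \<xi>)) y'"
      if C: "C \<in> N" and y: "(E \<xi>, y) \<in> Y" "(E \<eta>, y') \<in> ?Y'" for C \<xi> y \<eta> y'
    proof -
      have "(\<lambda>x. if x \<in> H then C x else 0) \<in> wcomm H (hatD ME) (full_closure ME)"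
        using N_reduced_in_wcomm[OF C] wcomm_full_closure[OF Ostar_vs_ME] by simp
      moreover have "y \<in> H" using y(1) LdagD(5)[OF YL] by auto
      ultimately show ?thesis
        using Y y unfolding wbicomm_def by fastforce
    qed
    \<comment> \<open>For a graph \<open>Z\<close> this is the composition of \<open>Z\<close> after
      \<open>E\<close>, with domain \<open>D\<close> when \<open>Z\<close> is defined on all of
      \<open>hatD ME\<close>.\<close>
    define lift where "lift Z = {(\<xi>, y). \<xi> \<in> D \<and> (E \<xi>, y) \<in> Z}" for Z :: "('h \<times> 'h) set"
    have in_lift: "(\<xi>, y) \<in> lift Z \<longleftrightarrow> \<xi> \<in> D \<and> (E \<xi>, y) \<in> Z" for \<xi> y Z
      by (simp add: lift_def)
    have E_hatD: "E \<xi> \<in> hatD ME" if "\<xi> \<in> D" for \<xi>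
      using that D_subset_hatD[OF Ostar_vs_ME] by blast
    have Domain_lift: "Domain (lift Z) = D" if "Z \<in> Ldag H (hatD ME)" for Z
      using E_hatD unfolding LdagD(2)[OF that, symmetric] by (auto simp: in_lift Domain_iff)
    \<comment> \<open>Values of \<open>Y\<close> and \<open>?Y'\<close> are fixed by
      \<open>E\<close>, so moving \<open>E\<close> across the inner product leaves just the lift of
      \<open>?Y'\<close>.\<close>
    have lift_adj: "lift ?Y' \<subseteq> adj UNIV (lift Y)"
    proof clarify
      fix \<eta> y' assume "(\<eta>, y') \<in> lift ?Y'"
      then have y': "(E \<eta>, y') \<in> adj H Y" by (simp add: in_lift in_dag_iff)
      have "E y' = y'" using y' adj_subset[of H Y] in_H_iff by blast
      show "(\<eta>, y') \<in> adj UNIV (lift Y)"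
      proof (intro adjI UNIV_I)
        fix \<xi> y assume "(\<xi>, y) \<in> lift Y"
        then have y: "(E \<xi>, y) \<in> Y" by (simp add: in_lift)
        then have "E y = y" using LdagD(5)[OF YL] in_H_iff by blast
        then show "cinner y \<eta> = cinner \<xi> y'"
          using adjD[OF y' y] cinner_E_right[of y \<eta>] cinner_E_left[of y' \<xi>] \<open>E y' = y'\<close> by simp
      qed
    qed
    have lift_L: "lift Y \<in> Ldag UNIV D"
    proof (rule LdagI[OF dense_D])
      show "csubspace (lift Y)"
        using dense_subspaceD(3)[OF dense_D] csubspace_PairD[OF LdagD(4)[OF YL]]
        unfolding csubspace_def zero_prod_def by (auto simp: in_lift E_add E_scaleC E_0)
      show "\<exists>y. (\<eta>, y) \<in> adj UNIV (lift Y)" if "\<eta> \<in> D" for \<eta>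
        using that lift_adj Domain_lift[OF Y'L] by blast
    qed (simp_all add: Domain_lift[OF YL])
    have dag_lift: "dag UNIV D (lift Y) = lift ?Y'"
      by (rule dag_eqI[OF dense_D lift_L lift_adj Domain_lift[OF Y'L]])
    have "lift Y \<in> wbicomm UNIV D M"
      unfolding wbicomm_def
    proof (intro CollectI conjI lift_L ballI, clarify)
      fix C \<xi> y \<eta> y'
      assume C: "C \<in> N" and "(\<xi>, y) \<in> lift Y" "(\<eta>, y') \<in> dag UNIV D (lift Y)"
      then have y: "(E \<xi>, y) \<in> Y" and y': "(E \<eta>, y') \<in> ?Y'" by (auto simp: dag_lift in_lift)
      have Ey: "E y = y" "E y' = y'"
        using y y' LdagD(5)[OF YL] LdagD(5)[OF Y'L] in_H_iff by blast+
      have "cinner (C y) \<eta> = cinner (C y) (E \<eta>)"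
        using N_commutes_E[OF C, of y] Ey by (simp add: cinner_E_right)
      also have "\<dots> = cinner (C (E \<xi>)) y'"
        by (rule Y_comm[OF C y y'])
      also have "\<dots> = cinner (C \<xi>) y'"
        using Ey by (simp add: N_commutes_E[OF C] cinner_E_left)
      finally show "cinner (C y) \<eta> = cinner (C \<xi>) y'" .
    qed
    then have lift_M: "lift Y \<in> M"
      by (rule in_M_if_wbicomm)
    have "reduce E D (lift ?Y') \<subseteq> ?Y'"
    proof clarify
      fix \<eta> z assume "(\<eta>, z) \<in> reduce E D (lift ?Y')"
      then obtain y where \<eta>: "\<eta> \<in> E ` D" and y: "(E \<eta>, y) \<in> ?Y'" and z: "z = E y"
        by (auto simp: in_reduce_iff in_lift)
      have "E y = y"
        using y LdagD(5)[OF Y'L] in_H_iff by blast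
      with y show "(\<eta>, z) \<in> ?Y'"
        unfolding z E_on_ED[OF \<eta>] by simp
    qed
    then have "Y \<subseteq> adj H (dag H (E ` D) (reduce E D (lift Y)))"
      using subset_adj_dag[OF LdagD(5)[OF YL], of "hatD ME"] adj_mono
      unfolding dag_reduce[OF lift_M] dag_lift by blast
    then have "Y = hat_op ME (reduce E D (lift Y))"
      using lift_M LdagD(2)[OF YL] by (intro hat_op_eqI[OF Ostar_vs_ME]) auto
    then show "Y \<in> full_closure ME"
      using lift_M by (auto simp: full_closure_eq[OF Ostar_vs_ME])
  qed
qed

lemma partial_GW_full_closure_reduce: "partial_GW H (hatD ME) (full_closure ME)"
  unfolding partial_GW_def
proof (intro conjI ballI)
  show "partial_Oalg H (hatD ME) (full_closure ME)"
    by (rule partial_Oalg_if_wbicomm[OF full_closure_Ostar_vs[OF Ostar_vs_ME]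
          wcomm_reduced_invariant full_closure_bicommutant])
  show "fully_closed (hatD ME) (full_closure ME)"
    by (rule full_closure_fully_closed[OF Ostar_vs_ME])
qed (use wcomm_reduced_invariant full_closure_bicommutant in blast)+

end

theorem theorem2p3:
  fixes M :: "('h::chilbert_space \<times> 'h) set set" and D :: "'h set" and E :: "'h \<Rightarrow> 'h"
  assumes "partial_GW UNIV D M"
    and "is_proj E"
    and "op_of_fun D E \<in> M"
    and "E ` D \<subseteq> D"
  shows "partial_GW (range E) (hatD (reduce E D ` M)) (full_closure (reduce E D ` M))"
  using assms by (rule partial_GW_full_closure_reduce)

end
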